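(* Let $v\in G^\bullet$ and $u\in G^\circ$ be neighboring vertices of $\Lambda(G)$, let $c$ be the corner corresponding to the edge $(uv)$, and let $X_1$ and $X_2$ be real-valued spinors satisfying the propagation equation, defined locally (near $c$) on the double covers $\Upsilon^\times_{[v]}(G)$ and $\Upsilon^\times_{[u]}(G)$, respectively. Identify these double covers away from the lifts of $c$, and choose lifts of $c$ according to the convention given in the context. Define the increments of $H[X_1,X_2]$ by $$H[X_1,X_2](v(c'))-H[X_1,X_2](u(c')):=X_1(c')X_2(c')$$ for corners $c'=(u(c')v(c'))$. Then $H[X_1,X_2]$ has an additive monodromy $2X_1(c)X_2(c)$ when going around $c$ counterclockwise. In particular, if $X_{1,2}=X^{(m),\delta}_{1,2}$ are defined on an isoradial grid $\Lambda^\delta$ (with Z-invariant weights, $q=\frac12m\delta$) and the massive s-holomorphic functions $F^{(m),\delta}_{1,2}$ are constructed from $X^{(m),\delta}_{1,2}$, then $$2X^{(m),\delta}_1(c)X^{(m),\delta}_2(c)=\frac12\oint^{[(m),\delta]}\mathrm{Im}\big[F^{(m),\delta}_1(z)F^{(m),\delta}_2(z)\,dz\big],$$ where the discrete integral is taken along a closed contour surrounding $c=(uv)$ (counterclockwise).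
   Context: $G=G^\bullet$ is a planar graph with dual $G^\circ$; $\Lambda(G)$ is the planar graph with vertex set $G^\bullet\sqcup G^\circ$ and edges joining each $v\in G^\bullet$ to adjacent faces $u\in G^\circ$; its faces $z=(v_0u_0v_1u_1)$ are called quads and correspond to edges of $G$. Each quad carries a parameter $\widehat\theta_z\in(0,\frac\pi2)$. Corners $c=(u(c)v(c))$ are the edges of $\Lambda(G)$, i.e. the vertices of the medial graph $\Upsilon(G)$ of $\Lambda(G)$, whose faces correspond to vertices of $\Lambda(G)$ and to quads. $\Upsilon^\times_{\varpi}(G)$ is the double cover of $\Upsilon(G)$ branching around every face except those corresponding to vertices in $\varpi$. A spinor is a function whose values at the two lifts of a point differ by the sign. A spinor $X$ satisfies the propagation equation if for each quad $z$ with $v_0,v_1\in G^\bullet$, $u_0,u_1\in G^\circ$ (in any labelling) and $c_{pq}=(v_pu_q)$ one has $X(c_{00})=X(c_{01})\cos\widehat\theta_z+X(c_{10})\sin\widehat\theta_z$ whenever the lifts $c_{01},c_{10}$ are neighbors of the lift $c_{00}$ on the double cover. Convention on lifts: let $z^\pm$ be the two quads adjacent to the edge $(uv)$, so that $u$ is the next vertex to $v$ when going around $z^+$ counterclockwise. The double covers $\Upsilon^\times_{[v]}$ and $\Upsilon^\times_{[u]}$ are naturally identified everywhere except at the two lifts of $c$; the lifts of $c$ onto $\Upsilon^\times_{[v]}$ and $\Upsilon^\times_{[u]}$ are identified in such a way that the structure of these double covers around the quad $z^+$ is the same. Isoradial case: an isoradial grid $\Lambda^\delta$ of mesh size $\delta$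 is a tiling of $\mathbb{C}$ by rhombi of side $\delta$ (quads, identified with their centres), with bipartite vertex set (black $\Gamma^{\bullet,\delta}$ and white $\Gamma^{\circ,\delta}$); $\overline\theta_z$ is half of the angle of $z$ at its black vertices and $\sin\widehat\theta_z=\mathrm{sn}(\frac{2K}{\pi}\overline\theta_z|k)$, $\widehat\theta_z\in(0,\frac{\pi}{2})$, where $k,K$ are the elliptic modulus and complete elliptic integral with nome $q=\frac12m\delta$ ($k^2=\vartheta_2(q)^4/\vartheta_3(q)^4$, $K=\frac\pi2\vartheta_3(q)^2$). Given $X$, the massive s-holomorphic function $F$ is defined at quads by $\mathrm{Pr}[F(z);\widehat\eta_{c,z}\mathbb{R}]=\delta^{-\frac12}\widehat\eta_{c,z}X(c)$ for all $c\sim z$, where $\mathrm{Pr}[F;\eta\mathbb{R}]=\frac12(F+\eta^2\overline F)$ for $|\eta|=1$, $\widehat\eta_{c,z}=e^{i\frac\pi4}\exp[-\frac i2(\arg(v(c)-z)\pm\widehat\theta_z)]$ and the sign is such that $\arg(v(c)-u(c))=\arg(v(c)-z)\pm\overline\theta_z$. Discrete integral: $\frac12\oint^{[(m),\delta]}\mathrm{Im}[F_1F_2\,dz]$ along a nearest-neighbor closed path on black (or white) vertices is the sum over its steps of $\frac{\cos\widehat\theta_z}{\cos\overline\theta_z}\cdot\frac12\mathrm{Im}[F_1(z)F_2(z)(v_1-v_0)]$ for a step $v_0\to v_1$ between black vertices of a quad $z$, and of $\frac{\sin\widehat\theta_z}{\sin\overline\theta_z}\cdot\frac12\mathrm{Im}[F_1(z)F_2(z)(u_1-u_0)]$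 for a step $u_0\to u_1$ between white vertices of $z$. *)

theory Defs
  imports "HOL-Complex_Analysis.Complex_Analysis"
begin

section \<open>Planar graphs and the quadrangulation \<open>\<Lambda>(G)\<close>\<close>

text \<open>
  An embedded graph \<open>G\<close> is given by its darts (oriented edges): \<open>rot d\<close> is the next dart
  counterclockwise around the tail of \<open>d\<close>, and \<open>opp d\<close> is the reversed dart.  All objects
  derived from \<open>G\<close> are indexed by darts:
  \<^item> the corner \<open>d\<close>, an edge of \<open>\<Lambda>(G)\<close> and a vertex of \<open>\<Upsilon>(G)\<close>, is the sector between
    \<open>d\<close> and \<open>rot d\<close>; it joins the tail of \<open>d\<close> to the face on the left of \<open>d\<close>;
  \<^item> \<open>nextf d\<close> is the next corner counterclockwise around that face;
  \<^item> the quad \<open>d\<close> is the face of \<open>\<Lambda>(G)\<close> containing the edge of \<open>d\<close>, so the quads \<open>d\<close> and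
    \<open>opp d\<close> coincide.  With \<open>v\<^sub>0 = bv d\<close>, \<open>v\<^sub>1 = bv (opp d)\<close>, \<open>u\<^sub>0 = wv d\<close>,
    \<open>u\<^sub>1 = wv (opp d)\<close> its vertices are \<open>v\<^sub>0, u\<^sub>1, v\<^sub>1, u\<^sub>0\<close> in counterclockwise order
    and its corners \<open>c\<^sub>0\<^sub>0, c\<^sub>1\<^sub>0, c\<^sub>1\<^sub>1, c\<^sub>0\<^sub>1\<close> are
    \<open>d\<close>, \<open>nextf d\<close>, \<open>opp d = rot (nextf d)\<close>, \<open>nextf (opp d)\<close>, where
    \<open>rot (nextf (opp d)) = d\<close>;
  \<^item> the two quads at the corner \<open>d\<close> are therefore the quads \<open>d\<close> and \<open>rot d\<close>; the second one
    is \<open>z\<^sup>+\<close> (there the face follows the tail of \<open>d\<close> counterclockwise), the first is \<open>z\<^sup>-\<close>;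
  \<^item> each edge of \<open>\<Upsilon>(G)\<close> cuts off one vertex of one quad: the edges are \<open>d\<close> -- \<open>rot d\<close>
    (in the quad \<open>rot d\<close>) and \<open>d\<close> -- \<open>nextf d\<close> (in the quad \<open>d\<close>).
\<close>

record 'd emb_graph =
  rot :: "'d \<Rightarrow> 'd"
  opp :: "'d \<Rightarrow> 'd"

definition nextf :: "'d emb_graph \<Rightarrow> 'd \<Rightarrow> 'd" where
  "nextf G d = inv (rot G) (opp G d)"

definition orbit_of :: "('d \<Rightarrow> 'd) \<Rightarrow> 'd \<Rightarrow> 'd set" where
  "orbit_of f d = {e. \<exists>n. (f ^^ n) d = e \<or> (f ^^ n) e = d}"

datatype 'd lam_vertex = Black "'d set" | White "'d set"

definition bv :: "'d emb_graph \<Rightarrow> 'd \<Rightarrow> 'd lam_vertex" where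
  "bv G d = Black (orbit_of (rot G) d)"

definition wv :: "'d emb_graph \<Rightarrow> 'd \<Rightarrow> 'd lam_vertex" where
  "wv G d = White (orbit_of (nextf G) d)"

text \<open>
  Planarity is stated as the discrete Jordan property (genus zero): every finite cycle of
  edges of \<open>\<Lambda>(G)\<close> (even degree at every vertex) separates the quads, i.e. some set of quads
  changes exactly across the edges of the cycle.  For finite \<open>G\<close> this is Euler's formula.
\<close>

definition planar_graph :: "'d emb_graph \<Rightarrow> bool" where
  "planar_graph G \<longleftrightarrow>
     bij (rot G) \<and> (\<forall>d. opp G (opp G d) = d \<and> opp G d \<noteq> d) \<and>
     (\<forall>d. finite (orbit_of (rot G) d)) \<and>
     (\<forall>d e. (d, e) \<in> {(x, y). y = rot G x \<or> x = rot G y \<or> y = opp G x}\<^sup>*) \<and>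
     (\<forall>C. finite C \<longrightarrow>
        (\<forall>d. even (card {e \<in> C. bv G e = bv G d}) \<and> even (card {e \<in> C. wv G e = wv G d})) \<longrightarrow>
        (\<exists>S. (\<forall>d. opp G d \<in> S \<longleftrightarrow> d \<in> S) \<and>
             (\<forall>d. d \<in> C \<longleftrightarrow> (d \<in> S \<longleftrightarrow> rot G d \<notin> S))))"

definition quad_angles :: "'d emb_graph \<Rightarrow> ('d \<Rightarrow> real) \<Rightarrow> bool" where
  "quad_angles G \<theta> \<longleftrightarrow> (\<forall>d. \<theta> (opp G d) = \<theta> d \<and> 0 < \<theta> d \<and> \<theta> d < pi / 2)"

section \<open>Double covers of \<open>\<Upsilon>(G)\<close> and spinors\<close>

text \<open>
  A double cover of the graph \<open>\<Upsilon>(G)\<close>: \<open>lrot l\<close> and \<open>lnextf l\<close> are the neighbours of the lift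
  \<open>l\<close> along the lifts of the edges \<open>d\<close> -- \<open>rot d\<close> and \<open>d\<close> -- \<open>nextf d\<close>, \<open>d = proj l\<close>.
\<close>

record ('d, 'l) dcover =
  proj :: "'l \<Rightarrow> 'd"
  lrot :: "'l \<Rightarrow> 'l"
  lnextf :: "'l \<Rightarrow> 'l"

definition double_cover :: "'d emb_graph \<Rightarrow> ('d, 'l) dcover \<Rightarrow> bool" where
  "double_cover G K \<longleftrightarrow>
     (\<forall>d. card {l. proj K l = d} = 2) \<and> bij (lrot K) \<and> bij (lnextf K) \<and>
     (\<forall>l. proj K (lrot K l) = rot G (proj K l) \<and> proj K (lnextf K l) = nextf G (proj K l))"

text \<open>
  \<open>\<Upsilon>\<^sup>\<times>\<^sub>\<Omega>(G)\<close>: going once around a face of \<open>\<Upsilon>(G)\<close> changes the lift, except for the faces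
  corresponding to vertices in \<open>\<Omega>\<close>.  (Faces of \<open>\<Upsilon>(G)\<close> of infinite degree, which can only
  come from faces of \<open>G\<close>, cannot be gone around.)  A finite \<open>G\<close> has an odd number of faces
  of \<open>\<Upsilon>(G)\<close> besides any given one, hence no cover for \<open>|\<Omega>| = 1\<close>; there, a local
  statement about \<open>\<Omega> = {v}\<close> applies to \<open>\<Omega>\<close> with further vertices added.
\<close>

definition upsilon_cover :: "'d emb_graph \<Rightarrow> 'd lam_vertex set \<Rightarrow> ('d, 'l) dcover \<Rightarrow> bool" where
  "upsilon_cover G \<Omega> K \<longleftrightarrow> double_cover G K \<and>
     (\<forall>l. finite (orbit_of (rot G) (proj K l)) \<longrightarrow>
        ((lrot K ^^ card (orbit_of (rot G) (proj K l))) l = l \<longleftrightarrow> bv G (proj K l) \<in> \<Omega>)) \<and>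
     (\<forall>l. finite (orbit_of (nextf G) (proj K l)) \<longrightarrow>
        ((lnextf K ^^ card (orbit_of (nextf G) (proj K l))) l = l \<longleftrightarrow> wv G (proj K l) \<in> \<Omega>)) \<and>
     (\<forall>l. lrot K (lnextf K (lrot K (lnextf K l))) \<noteq> l)"

definition spinor :: "('d, 'l) dcover \<Rightarrow> ('l \<Rightarrow> real) \<Rightarrow> bool" where
  "spinor K X \<longleftrightarrow> (\<forall>l l'. proj K l = proj K l' \<and> l \<noteq> l' \<longrightarrow> X l' = - X l)"

text \<open>
  The propagation equation in the quads of a set \<open>D\<close>.  A spinor defined only over the corners
  of the quads of \<open>D\<close> is extended by \<open>0\<close>.  In a quad, the first equation is the one
  for the two corners of the form \<open>rot d\<close>, where \<open>rot d\<close> is a dart of the quad, with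
  neighbours \<open>d\<close> (same black vertex) and \<open>nextf (rot d)\<close> (same white vertex); the second
  one is for the other two corners \<open>nextf d\<close>, with neighbours \<open>rot (nextf d)\<close> and \<open>d\<close>.
\<close>

definition propagation ::
  "'d emb_graph \<Rightarrow> ('d \<Rightarrow> real) \<Rightarrow> 'd set \<Rightarrow> ('d, 'l) dcover \<Rightarrow> ('l \<Rightarrow> real) \<Rightarrow> bool" where
  "propagation G \<theta> D K X \<longleftrightarrow>
     (\<forall>l. rot G (proj K l) \<in> D \<longrightarrow>
        X (lrot K l) = X l * cos (\<theta> (rot G (proj K l)))
                     + X (lnextf K (lrot K l)) * sin (\<theta> (rot G (proj K l)))) \<and>
     (\<forall>l. proj K l \<in> D \<longrightarrow>
        X (lnextf K l) = X (lrot K (lnextf K l)) * cos (\<theta> (proj K l))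
                       + X l * sin (\<theta> (proj K l)))"

text \<open>
  Identification of \<open>\<Upsilon>\<^sup>\<times>\<^sub>[\<^sub>v\<^sub>]\<close> with \<open>\<Upsilon>\<^sup>\<times>\<^sub>[\<^sub>u\<^sub>]\<close> away from the lifts of \<open>c = (uv)\<close>,
  extended to the lifts of \<open>c\<close> so that the structures around \<open>z\<^sup>+\<close> agree.  Of the four edges
  of \<open>\<Upsilon>(G)\<close> at \<open>c\<close>, those in \<open>z\<^sup>-\<close> are the edge from the \<open>rot\<close>-predecessor of \<open>c\<close> to \<open>c\<close>
  and the edge \<open>c\<close> -- \<open>nextf c\<close>; these are the only ones not required to be preserved.
\<close>

definition cover_identification ::
  "'d emb_graph \<Rightarrow> 'd \<Rightarrow> ('d, 'l1) dcover \<Rightarrow> ('d, 'l2) dcover \<Rightarrow> ('l1 \<Rightarrow> 'l2) \<Rightarrow> bool" where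
  "cover_identification G c K1 K2 \<iota> \<longleftrightarrow>
     bij \<iota> \<and> (\<forall>l. proj K2 (\<iota> l) = proj K1 l) \<and>
     (\<forall>l. rot G (proj K1 l) \<noteq> c \<longrightarrow> \<iota> (lrot K1 l) = lrot K2 (\<iota> l)) \<and>
     (\<forall>l. proj K1 l \<noteq> c \<longrightarrow> \<iota> (lnextf K1 l) = lnextf K2 (\<iota> l))"

section \<open>The function \<open>H\<close> and its monodromy\<close>

text \<open>
  A closed walk on \<open>\<Lambda>(G)\<close> is a list of steps; \<open>(d, True)\<close> traverses the corner \<open>d\<close> from its
  white to its black end, and \<open>(d, False)\<close> in the opposite direction.
\<close>

definition step_start :: "'d emb_graph \<Rightarrow> 'd \<times> bool \<Rightarrow> 'd lam_vertex" where
  "step_start G s = (if snd s then wv G (fst s) else bv G (fst s))"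

definition step_end :: "'d emb_graph \<Rightarrow> 'd \<times> bool \<Rightarrow> 'd lam_vertex" where
  "step_end G s = (if snd s then bv G (fst s) else wv G (fst s))"

definition closed_walk :: "'d emb_graph \<Rightarrow> ('d \<times> bool) list \<Rightarrow> bool" where
  "closed_walk G \<gamma> \<longleftrightarrow>
     (\<forall>i < length \<gamma>. step_end G (\<gamma> ! i) = step_start G (\<gamma> ! (Suc i mod length \<gamma>)))"

text \<open>
  \<open>w\<close> assigns to each quad in \<open>D\<close> the winding number of \<open>\<gamma>\<close> around it, and \<open>\<gamma>\<close> does not wind
  around anything outside \<open>D\<close>: as a chain, \<open>\<gamma>\<close> is the boundary of the finite 2-chain \<open>w\<close>.  The
  quad on the left of the step \<open>(d, True)\<close> is the quad \<open>d\<close>, the one on the right is \<open>rot d\<close>.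
  If \<open>\<gamma>\<close> does not traverse \<open>d\<close>, then \<open>w d = w (rot d)\<close> is its winding number around the corner \<open>d\<close>.
\<close>

definition winding_in ::
  "'d emb_graph \<Rightarrow> 'd set \<Rightarrow> ('d \<times> bool) list \<Rightarrow> ('d \<Rightarrow> int) \<Rightarrow> bool" where
  "winding_in G D \<gamma> w \<longleftrightarrow>
     finite {d. w d \<noteq> 0} \<and> {d. w d \<noteq> 0} \<subseteq> D \<and> (\<forall>d. w (opp G d) = w d) \<and>
     (\<forall>d. int (count_list \<gamma> (d, True)) - int (count_list \<gamma> (d, False)) = w d - w (rot G d))"

text \<open>
  \<open>h 0, h 1, \<dots>\<close> are the values of (a branch of) \<open>H[X\<^sub>1, X\<^sub>2]\<close> continued along the walk \<open>\<gamma>\<close>,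
  i.e. \<open>H(v(c')) - H(u(c')) = X\<^sub>1(c') X\<^sub>2(c')\<close> for each traversed corner \<open>c'\<close>.
\<close>

definition H_along ::
  "('d, 'l1) dcover \<Rightarrow> ('l1 \<Rightarrow> 'l2) \<Rightarrow> ('l1 \<Rightarrow> real) \<Rightarrow> ('l2 \<Rightarrow> real) \<Rightarrow>
   ('d \<times> bool) list \<Rightarrow> (nat \<Rightarrow> real) \<Rightarrow> bool" where
  "H_along K1 \<iota> X1 X2 \<gamma> h \<longleftrightarrow>
     (\<forall>i < length \<gamma>. \<forall>l. proj K1 l = fst (\<gamma> ! i) \<longrightarrow>
        (if snd (\<gamma> ! i) then h (Suc i) - h i = X1 l * X2 (\<iota> l)
                        else h i - h (Suc i) = X1 l * X2 (\<iota> l)))"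

section \<open>Isoradial grids and Z-invariant weights\<close>

definition rhombus :: "'d emb_graph \<Rightarrow> ('d lam_vertex \<Rightarrow> complex) \<Rightarrow> 'd \<Rightarrow> complex set" where
  "rhombus G pos d = convex hull
     {pos (bv G d), pos (wv G (opp G d)), pos (bv G (opp G d)), pos (wv G d)}"

definition center :: "'d emb_graph \<Rightarrow> ('d lam_vertex \<Rightarrow> complex) \<Rightarrow> 'd \<Rightarrow> complex" where
  "center G pos d = (pos (bv G d) + pos (bv G (opp G d))) / 2"

text \<open>
  The third condition says that the vertices \<open>v\<^sub>0, u\<^sub>1, v\<^sub>1, u\<^sub>0\<close> of each quad (whose sides are
  equal by the second condition) form a nondegenerate rhombus, in counterclockwise order.
\<close>

definition isoradial_grid ::
  "'d emb_graph \<Rightarrow> ('d lam_vertex \<Rightarrow> complex) \<Rightarrow> real \<Rightarrow> bool" where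
  "isoradial_grid G pos \<delta> \<longleftrightarrow>
     0 < \<delta> \<and> inj_on pos (range (bv G) \<union> range (wv G)) \<and>
     (\<forall>d. dist (pos (bv G d)) (pos (wv G d)) = \<delta>) \<and>
     (\<forall>d. 0 < Im (cnj (pos (bv G (opp G d)) - pos (bv G d)) *
                       (pos (wv G d) - pos (wv G (opp G d))))) \<and>
     (\<Union>d. rhombus G pos d) = UNIV \<and>
     (\<forall>d e. e \<noteq> d \<and> e \<noteq> opp G d \<longrightarrow>
        interior (rhombus G pos d) \<inter> interior (rhombus G pos e) = {}) \<and>
     (\<forall>r. finite {d. rhombus G pos d \<inter> cball 0 r \<noteq> {}})"

definition half_angle :: "'d emb_graph \<Rightarrow> ('d lam_vertex \<Rightarrow> complex) \<Rightarrow> 'd \<Rightarrow> real" where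
  "half_angle G pos d =
     Arg ((pos (wv G d) - pos (bv G d)) / (pos (wv G (opp G d)) - pos (bv G d))) / 2"

text \<open>
  Jacobi's \<open>sn(x | k)\<close> as the sine of the amplitude, i.e. of the inverse of the incomplete
  elliptic integral of the first kind; the argument \<open>k2\<close> stands for \<open>k\<^sup>2 < 1\<close>, which is negative
  for negative nomes.  \<open>theta2_pow4 q\<close> is \<open>\<vartheta>\<^sub>2(q)\<^sup>4\<close>, where
  \<open>\<vartheta>\<^sub>2(q) = 2 q\<^sup>1\<^sup>/\<^sup>4 \<Sum>\<^sub>n q\<^sup>n\<^sup>(\<^sup>n\<^sup>+\<^sup>1\<^sup>)\<close>.
\<close>

definition elliptic_F :: "real \<Rightarrow> real \<Rightarrow> real" where
  "elliptic_F k2 \<phi> = interval_lebesgue_integral lborel 0 (ereal \<phi>)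
     (\<lambda>t. 1 / sqrt (1 - k2 * (sin t)\<^sup>2))"

definition jacobi_sn :: "real \<Rightarrow> real \<Rightarrow> real" where
  "jacobi_sn k2 x = sin (THE \<phi>. elliptic_F k2 \<phi> = x)"

definition theta2_pow4 :: "real \<Rightarrow> real" where
  "theta2_pow4 q = 16 * q * (\<Sum>n. q ^ (n * (n + 1))) ^ 4"

definition theta3 :: "real \<Rightarrow> real" where
  "theta3 q = 1 + 2 * (\<Sum>n. q ^ ((n + 1)\<^sup>2))"

definition modulus_sq :: "real \<Rightarrow> real" where
  "modulus_sq q = theta2_pow4 q / theta3 q ^ 4"

definition quarter_period :: "real \<Rightarrow> real" where
  "quarter_period q = pi / 2 * (theta3 q)\<^sup>2"

definition Z_invariant ::
  "'d emb_graph \<Rightarrow> ('d lam_vertex \<Rightarrow> complex) \<Rightarrow> real \<Rightarrow> ('d \<Rightarrow> real) \<Rightarrow> bool" where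
  "Z_invariant G pos q \<theta> \<longleftrightarrow>
     (\<forall>d. sin (\<theta> d) =
        jacobi_sn (modulus_sq q) (2 * quarter_period q / pi * half_angle G pos d))"

section \<open>Massive s-holomorphic functions and discrete integrals\<close>

definition Pr :: "complex \<Rightarrow> complex \<Rightarrow> complex" where
  "Pr F \<eta> = (F + \<eta>\<^sup>2 * cnj F) / 2"

text \<open>
  The lifts of a quad to a double cover: \<open>quad_lift K l\<close> lists lifts of the corners
  \<open>c\<^sub>0\<^sub>0, c\<^sub>1\<^sub>0, c\<^sub>1\<^sub>1, c\<^sub>0\<^sub>1\<close> of the quad \<open>proj K l\<close>, successive entries being neighbours.
\<close>

definition quad_lift :: "('d, 'l) dcover \<Rightarrow> 'l \<Rightarrow> 'l list" where
  "quad_lift K l =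
     [l, lnextf K l, lrot K (lnextf K l), lnextf K (lrot K (lnextf K l))]"

text \<open>
  \<open>F\<close> is the value at the quad \<open>z = proj K l\<close> of the massive s-holomorphic function constructed
  from \<open>X\<close>.  Since \<open>X\<close> and \<open>c \<mapsto> \<eta>\<^sub>c\<^sub>,\<^sub>z\<close> are defined on double covers, the value depends
  on the lift of \<open>z\<close>, given here by \<open>l\<close>, and on a value \<open>\<beta>\<close> of \<open>arg (v\<^sub>0 - z)\<close>; changing either
  choice changes the sign of \<open>F\<close>.  As for the continuous branch of \<open>arg (v(c) - u(c))\<close>
  along \<open>\<Upsilon>(G)\<close>, the branch of \<open>arg (v(c) - z)\<close> increases by \<open>\<pi>\<close> when passing from one
  corner of \<open>z\<close> to the other counterclockwise around their common white vertex, and does not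
  change when passing between two corners at the same black vertex.
\<close>

definition s_hol_value ::
  "'d emb_graph \<Rightarrow> ('d lam_vertex \<Rightarrow> complex) \<Rightarrow> real \<Rightarrow> ('d \<Rightarrow> real) \<Rightarrow>
   ('d, 'l) dcover \<Rightarrow> ('l \<Rightarrow> real) \<Rightarrow> 'l \<Rightarrow> real \<Rightarrow> complex \<Rightarrow> bool" where
  "s_hol_value G pos \<delta> \<theta> K X l \<beta> F \<longleftrightarrow>
     (\<forall>j < 4. \<forall>s \<in> {1, - 1}.
        let z = proj K l; l' = quad_lift K l ! j; c = proj K l';
            a = [\<beta>, \<beta> + pi, \<beta> + pi, \<beta> + 2 * pi] ! j;
            \<eta> = cis (pi / 4) * cis (- (a + s * \<theta> z) / 2)
        in sgn (pos (bv G c) - pos (wv G c)) = cis (a + s * half_angle G pos z) \<longrightarrow>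
           Pr F \<eta> = of_real (\<delta> powr (- 1 / 2)) * \<eta> * of_real (X l'))"

text \<open>
  \<open>F1\<close> and \<open>F2\<close> are constructed from \<open>X1\<close> and \<open>X2\<close> in the quads of \<open>D\<close>, at each quad on
  lifts that correspond to each other under the identification of the double covers away
  from \<open>c\<close>, and with the same branch of \<open>arg\<close>.  This determines \<open>F1 z * F2 z\<close>.
\<close>

definition massive_s_hol_pair ::
  "'d emb_graph \<Rightarrow> ('d lam_vertex \<Rightarrow> complex) \<Rightarrow> real \<Rightarrow> ('d \<Rightarrow> real) \<Rightarrow> 'd set \<Rightarrow> 'd \<Rightarrow>
   ('d, 'l1) dcover \<Rightarrow> ('d, 'l2) dcover \<Rightarrow> ('l1 \<Rightarrow> 'l2) \<Rightarrow>
   ('l1 \<Rightarrow> real) \<Rightarrow> ('l2 \<Rightarrow> real) \<Rightarrow> (complex \<Rightarrow> complex) \<Rightarrow> (complex \<Rightarrow> complex) \<Rightarrow> bool" where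
  "massive_s_hol_pair G pos \<delta> \<theta> D c K1 K2 \<iota> X1 X2 F1 F2 \<longleftrightarrow>
     (\<forall>d \<in> D. \<exists>l1 l2 \<beta>. proj K1 l1 = d \<and> proj K2 l2 = d \<and>
        (\<forall>j < 4. proj K1 (quad_lift K1 l1 ! j) \<noteq> c \<longrightarrow>
           \<iota> (quad_lift K1 l1 ! j) = quad_lift K2 l2 ! j) \<and>
        sgn (pos (bv G d) - center G pos d) = cis \<beta> \<and>
        s_hol_value G pos \<delta> \<theta> K1 X1 l1 \<beta> (F1 (center G pos d)) \<and>
        s_hol_value G pos \<delta> \<theta> K2 X2 l2 \<beta> (F2 (center G pos d)))"

text \<open>
  A closed nearest-neighbour path on black (\<open>e = bv G\<close>) or white (\<open>e = wv G\<close>) vertices: the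
  step given by \<open>d\<close> runs from \<open>e d\<close> to \<open>e (opp d)\<close>, along a diagonal of the quad \<open>d\<close>.
\<close>

definition contour ::
  "'d emb_graph \<Rightarrow> ('d \<Rightarrow> 'd lam_vertex) \<Rightarrow> 'd list \<Rightarrow> bool" where
  "contour G e ds \<longleftrightarrow> ds \<noteq> [] \<and>
     (\<forall>i < length ds. e (opp G (ds ! i)) = e (ds ! (Suc i mod length ds)))"

fun polyline :: "complex list \<Rightarrow> real \<Rightarrow> complex" where
  "polyline [] = linepath 0 0"
| "polyline [a] = linepath a a"
| "polyline (a # b # xs) =
     (if xs = [] then linepath a b else linepath a b +++ polyline (b # xs))"

definition contour_path ::
  "('d lam_vertex \<Rightarrow> complex) \<Rightarrow> ('d \<Rightarrow> 'd lam_vertex) \<Rightarrow> 'd list \<Rightarrow> real \<Rightarrow> complex" where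
  "contour_path pos e ds = polyline (map (\<lambda>d. pos (e d)) (ds @ [hd ds]))"

text \<open>
  The contour runs through quads of \<open>D\<close>, surrounds the corner \<open>c\<close> (equivalently, the midpoint of
  that edge) once counterclockwise, and does not surround any point outside the quads of \<open>D\<close>.
\<close>

definition contour_around ::
  "'d emb_graph \<Rightarrow> ('d lam_vertex \<Rightarrow> complex) \<Rightarrow> 'd set \<Rightarrow> 'd \<Rightarrow>
   ('d \<Rightarrow> 'd lam_vertex) \<Rightarrow> 'd list \<Rightarrow> bool" where
  "contour_around G pos D c e ds \<longleftrightarrow> contour G e ds \<and> set ds \<subseteq> D \<and>
     winding_number (contour_path pos e ds) ((pos (bv G c) + pos (wv G c)) / 2) = 1 \<and>
     (\<forall>p. p \<notin> (\<Union>d \<in> D. rhombus G pos d) \<longrightarrow> winding_number (contour_path pos e ds) p = 0)"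

definition discrete_integral_black ::
  "'d emb_graph \<Rightarrow> ('d lam_vertex \<Rightarrow> complex) \<Rightarrow> ('d \<Rightarrow> real) \<Rightarrow>
   (complex \<Rightarrow> complex) \<Rightarrow> (complex \<Rightarrow> complex) \<Rightarrow> 'd list \<Rightarrow> real" where
  "discrete_integral_black G pos \<theta> F1 F2 ds =
     (\<Sum>d\<leftarrow>ds. cos (\<theta> d) / cos (half_angle G pos d) *
        (1 / 2 * Im (F1 (center G pos d) * F2 (center G pos d) *
                     (pos (bv G (opp G d)) - pos (bv G d)))))"

definition discrete_integral_white ::
  "'d emb_graph \<Rightarrow> ('d lam_vertex \<Rightarrow> complex) \<Rightarrow> ('d \<Rightarrow> real) \<Rightarrow>
   (complex \<Rightarrow> complex) \<Rightarrow> (complex \<Rightarrow> complex) \<Rightarrow> 'd list \<Rightarrow> real" where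
  "discrete_integral_white G pos \<theta> F1 F2 ds =
     (\<Sum>d\<leftarrow>ds. sin (\<theta> d) / sin (half_angle G pos d) *
        (1 / 2 * Im (F1 (center G pos d) * F2 (center G pos d) *
                     (pos (wv G (opp G d)) - pos (wv G d)))))"

end

theory Submission
  imports Defs
begin

text \<open>
The products \<open>X\<^sub>1 X\<^sub>2\<close> form a discrete 1-form on the edges of \<open>\<Lambda>(G)\<close> (the corners), and the
monodromy of its primitive \<open>H\<close> is the integral of this form along a closed walk.  Both claims are
instances of Stokes' formula for a form that is closed in every quad except one.

In one quad with lifted corners \<open>c\<^sub>0\<^sub>0, c\<^sub>1\<^sub>0, c\<^sub>1\<^sub>1, c\<^sub>0\<^sub>1\<close>, the propagation equation says that the pair of
values at \<open>c\<^sub>0\<^sub>0, c\<^sub>1\<^sub>1\<close> is an orthogonal transformation of the pair at \<open>c\<^sub>1\<^sub>0, c\<^sub>0\<^sub>1\<close>, with the same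
matrix for every spinor.  Hence the scalar products agree, which is closedness of \<open>X\<^sub>1 X\<^sub>2\<close>
(\<open>quad_products\<close>) as long as the four lifts on the two covers correspond to each other.  The
identification of the covers around \<open>[v]\<close> and \<open>[u]\<close> respects the structure of all quads but \<open>z\<^sup>-\<close>.
There it cannot, since going once around \<open>v\<close> closes up on one cover and not on the other
(\<open>iota_lnextf_at_c\<close>); so in \<open>z\<^sup>-\<close> the product at \<open>c\<close> enters with the wrong sign, and the form has the
defect \<open>2 X\<^sub>1(c) X\<^sub>2(c)\<close> (\<open>corner_prod_quad\<close>).  Summation by parts against the winding numbers gives the
monodromy (\<open>sum_signed_prod\<close>).

On an isoradial grid, the values of \<open>X\<close> at the corners of a rhombus are the components of \<open>F(z)\<close> in
four directions.  A computation in one rhombus shows that the summand of the discrete integral for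
a step along a diagonal is the increment of \<open>H\<close> along either pair of sides with the same ends
(\<open>integrand_black_white\<close>), where a pair of sides through \<open>c\<close> has to be avoided.  Replacing each
diagonal by two sides turns the contour into a walk on \<open>\<Lambda>(G)\<close>.  It is convenient to use the sides on
the same side of the diagonal in every step, even if they contain \<open>c\<close>: each passage through \<open>c\<close>
changes the winding number of the walk at \<open>z\<^sup>-\<close> by one, and this exactly compensates the sign error
that it makes in the increments.

What remains is that the combinatorial winding numbers of the walk come from the topological ones of
the polygonal contour.  These are evaluated at the midpoints of the corners, which lie on no diagonal
because the two rhombi at a corner cover a neighbourhood of its midpoint.  Between midpoints of
neighbouring corners of a rhombus, the winding number changes only if the diagonal between them is
traversed, and then by \<open>\<plusminus>1\<close> for each traversal (\<open>turns_jump\<close>): the contour integral of \<open>1/(z-p) - 1/(z-q)\<close> telescopes with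
the primitive \<open>Ln ((z-p)/(z-q))\<close>, whose cut is the segment from \<open>p\<close> to \<open>q\<close>.
\<close>

section \<open>Darts and the vertices of the quadrangulation\<close>

text \<open>
  Orbits are taken in both time directions, so a step along the orbit does not change it even if it is
  infinite.  This gives the incidences of corners with vertices of \<open>\<Lambda>(G)\<close>.
\<close>

lemma orbit_of_step:
  assumes "inj f"
  shows "orbit_of f (f d) = orbit_of f d"
proof (rule set_eqI)
  fix e
  have a: "(\<exists>n. (f ^^ n) (f d) = e \<or> (f ^^ n) e = f d) \<Longrightarrow> (\<exists>n. (f ^^ n) d = e \<or> (f ^^ n) e = d)"
  proof (elim exE disjE)
    fix n assume "(f ^^ n) (f d) = e"
    then have "(f ^^ Suc n) d = e" by (simp only: funpow_Suc_right o_apply)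
    then show ?thesis by blast
  next
    fix n assume n: "(f ^^ n) e = f d"
    show ?thesis
    proof (cases n)
      case 0
      then have "(f ^^ 1) d = e" using n by simp
      then show ?thesis by blast
    next
      case (Suc k)
      then have "(f ^^ k) e = d" using n assms by (simp add: inj_eq)
      then show ?thesis by blast
    qed
  qed
  have b: "(\<exists>n. (f ^^ n) d = e \<or> (f ^^ n) e = d) \<Longrightarrow> (\<exists>n. (f ^^ n) (f d) = e \<or> (f ^^ n) e = f d)"
  proof (elim exE disjE)
    fix n assume n: "(f ^^ n) d = e"
    show ?thesis
    proof (cases n)
      case 0
      then have "(f ^^ 1) e = f d" using n by simp
      then show ?thesis by blast
    next
      case (Suc k)
      then have "(f ^^ k) (f d) = e" using n by (simp only: funpow_Suc_right o_apply)
      then show ?thesis by blast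
    qed
  next
    fix n assume "(f ^^ n) e = d"
    then have "(f ^^ Suc n) e = f d" by simp
    then show ?thesis by blast
  qed
  show "e \<in> orbit_of f (f d) \<longleftrightarrow> e \<in> orbit_of f d"
    unfolding orbit_of_def using a b by blast
qed

locale dart_graph =
  fixes G :: "'d emb_graph"
  assumes bij_rot: "bij (rot G)"
    and opp_opp [simp]: "opp G (opp G d) = d"
    and opp_neq [simp]: "opp G d \<noteq> d"
begin

lemma rot_eq_iff [simp]: "rot G x = rot G y \<longleftrightarrow> x = y"
  using bij_rot by (simp add: bij_def inj_eq)

lemma opp_eq_iff [simp]: "opp G x = opp G y \<longleftrightarrow> x = y"
  by (metis opp_opp)

lemma rot_nextf [simp]: "rot G (nextf G d) = opp G d"
  unfolding nextf_def using bij_rot by (simp add: bij_def surj_f_inv_f)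

lemma nextf_opp_rot [simp]: "nextf G (opp G (rot G d)) = d"
proof -
  have "rot G (nextf G (opp G (rot G d))) = rot G d" by simp
  then show ?thesis by (simp only: rot_eq_iff)
qed

lemma nextf_eq_iff: "nextf G x = y \<longleftrightarrow> x = opp G (rot G y)"
  by (metis nextf_opp_rot opp_opp rot_nextf)

lemma inj_nextf: "inj (nextf G)"
  by (rule injI) (metis nextf_eq_iff)

lemma bv_rot [simp]: "bv G (rot G d) = bv G d"
  using bij_rot by (simp add: bv_def orbit_of_step bij_def)

lemma wv_nextf [simp]: "wv G (nextf G d) = wv G d"
  by (simp add: wv_def orbit_of_step inj_nextf)

lemma bv_nextf [simp]: "bv G (nextf G d) = bv G (opp G d)"
  by (metis bv_rot rot_nextf)

end

lemma planar_graph_imp_dart_graph: "planar_graph G \<Longrightarrow> dart_graph G"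
  by (auto simp: planar_graph_def dart_graph_def)

section \<open>Spinors on one double cover of a quad\<close>

lemma two_lifts:
  assumes "double_cover G K" and "proj K a = proj K b" and "proj K b = proj K e"
  shows "a = b \<or> b = e \<or> a = e"
proof -
  have "card {l. proj K l = proj K a} = 2"
    using assms(1) by (simp add: double_cover_def)
  then obtain x y where "{l. proj K l = proj K a} = {x, y}"
    by (auto simp: card_2_iff)
  moreover have "a \<in> {l. proj K l = proj K a}" "b \<in> {l. proj K l = proj K a}"
    "e \<in> {l. proj K l = proj K a}"
    using assms by auto
  ultimately show ?thesis by auto
qed

lemma exists_lift:
  assumes "double_cover G K"
  obtains l where "proj K l = d"
proof -
  have "card {l. proj K l = d} = 2"
    using assms by (simp add: double_cover_def)
  then have "{l. proj K l = d} \<noteq> {}" by (metis card.empty zero_neq_numeral)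
  then show ?thesis using that by auto
qed

lemma double_cover_projs:
  assumes "double_cover G K"
  shows "proj K (lrot K l) = rot G (proj K l)" and "proj K (lnextf K l) = nextf G (proj K l)"
    and "lrot K l = lrot K l' \<longleftrightarrow> l = l'" and "lnextf K l = lnextf K l' \<longleftrightarrow> l = l'"
  using assms by (auto simp: double_cover_def bij_def inj_eq)

lemma spinor_flip:
  assumes "spinor K X" and "proj K a = proj K b" and "a \<noteq> b"
  shows "X b = - X a"
  using assms by (auto simp: spinor_def)

text \<open>
  The entries after the first of \<open>quad_lift\<close>, named so that they can be rewritten separately.
\<close>

definition lift1 where "lift1 K l = lnextf K l"
definition lift2 where "lift2 K l = lrot K (lift1 K l)"
definition lift3 where "lift3 K l = lnextf K (lift2 K l)"

lemmas lift_defs = lift1_def lift2_def lift3_def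

lemma lift_quad_lift:
  "quad_lift K l = [l, lift1 K l, lift2 K l, lift3 K l]"
  by (simp add: quad_lift_def lift_defs)

lemma (in dart_graph) proj_lift:
  assumes "double_cover G K"
  shows "proj K (lift1 K l) = nextf G (proj K l)"
    and "proj K (lift2 K l) = opp G (proj K l)"
    and "proj K (lift3 K l) = nextf G (opp G (proj K l))"
    and "proj K (lrot K (lift3 K l)) = proj K l"
  using double_cover_projs(1,2)[OF assms] by (simp_all add: lift_defs)

text \<open>
  Continuing the four lifts once around the quad leads from \<open>l\<close> to the other lift of the same corner,
  where the spinor has the opposite sign.  Thus one of the four corners gets a minus sign, and two of the
  four propagation equations express the values at \<open>c\<^sub>0\<^sub>0, c\<^sub>1\<^sub>1\<close> by those at \<open>c\<^sub>1\<^sub>0, c\<^sub>0\<^sub>1\<close> through an orthogonal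
  matrix.
\<close>

lemma (in dart_graph) propagation_in_quad:
  assumes "double_cover G K" and "lrot K (lift3 K l) \<noteq> l" and "spinor K X"
    and "propagation G \<theta> D K X" and "proj K l \<in> D" and "opp G (proj K l) \<in> D"
    and "\<theta> (opp G (proj K l)) = \<theta> (proj K l)"
  defines "t \<equiv> \<theta> (proj K l)"
  shows "X l = X (lift1 K l) * sin t - X (lift3 K l) * cos t"
    and "X (lift2 K l) = X (lift1 K l) * cos t + X (lift3 K l) * sin t"
proof -
  note pr = proj_lift[OF assms(1)]
  let ?m = "lrot K (lift3 K l)"
  have m: "X ?m = - X l" using spinor_flip[OF assms(3), of l ?m] assms(2) pr by auto
  have m1: "X (lnextf K ?m) = - X (lift1 K l)"
    using spinor_flip[OF assms(3), of "lift1 K l" "lnextf K ?m"] assms(2) pr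
      double_cover_projs[OF assms(1)] by (auto simp: lift1_def)
  have "X (lrot K (lift1 K l)) = X (lift1 K l) * cos (\<theta> (opp G (proj K l)))
     + X (lnextf K (lrot K (lift1 K l))) * sin (\<theta> (opp G (proj K l)))"
    using assms(4,6) pr rot_nextf unfolding propagation_def by metis
  then show "X (lift2 K l) = X (lift1 K l) * cos t + X (lift3 K l) * sin t"
    using assms by (simp add: lift_defs t_def)
  have "rot G (proj K (lift3 K l)) = proj K l"
    using pr by simp
  then have "X ?m = X (lift3 K l) * cos t + X (lnextf K ?m) * sin t"
    using assms(4,5) unfolding propagation_def t_def by metis
  then show "X l = X (lift1 K l) * sin t - X (lift3 K l) * cos t"
    using m m1 by simp
qed

lemma rotated_products:
  fixes x0 x1 x2 x3 y0 y1 y2 y3 t :: real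
  assumes "x0 = x1 * sin t - x3 * cos t" "x2 = x1 * cos t + x3 * sin t"
    and "y0 = y1 * sin t - y3 * cos t" "y2 = y1 * cos t + y3 * sin t"
  shows "x0 * y0 + x2 * y2 = x1 * y1 + x3 * y3"
proof -
  have "x0 * y0 + x2 * y2 = (x1 * y1 + x3 * y3) * ((sin t)\<^sup>2 + (cos t)\<^sup>2)"
    unfolding assms by algebra
  then show ?thesis by simp
qed

section \<open>Products of two spinors and their monodromy\<close>

lemma sum_list_count_real:
  fixes f :: "'a \<Rightarrow> real"
  assumes "finite X" and "set xs \<subseteq> X"
  shows "(\<Sum>x\<leftarrow>xs. f x) = (\<Sum>x\<in>X. real (count_list xs x) * f x)"
  using assms(2)
proof (induction xs)
  case (Cons y xs)
  have "(\<Sum>x\<in>X. real (count_list (y # xs) x) * f x)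
      = (\<Sum>x\<in>X. (if y = x then f x else 0) + real (count_list xs x) * f x)"
    by (intro sum.cong refl) (simp add: algebra_simps)
  also have "\<dots> = f y + (\<Sum>x\<in>X. real (count_list xs x) * f x)"
    using Cons.prems assms(1) by (simp add: sum.distrib)
  finally show ?case using Cons by simp
qed simp

text \<open>
  Kept apart from any embedding into the plane, since the monodromy of \<open>H\<close> is purely combinatorial.
\<close>

locale spinor_pair = dart_graph G
  for G :: "'d emb_graph" +
  fixes \<theta> :: "'d \<Rightarrow> real" and c :: 'd and D :: "'d set" and \<Omega> :: "'d lam_vertex set"
    and K1 :: "('d, 'l1) dcover" and K2 :: "('d, 'l2) dcover" and \<iota> :: "'l1 \<Rightarrow> 'l2"
    and X1 :: "'l1 \<Rightarrow> real" and X2 :: "'l2 \<Rightarrow> real"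
  assumes finite_orbit: "finite (orbit_of (rot G) c)"
    and angle_opp: "\<theta> (opp G d) = \<theta> d"
    and opp_in_D: "opp G d \<in> D \<longleftrightarrow> d \<in> D"
    and bv_notin: "bv G c \<notin> \<Omega>"
    and cover1: "upsilon_cover G (insert (bv G c) \<Omega>) K1"
    and cover2: "upsilon_cover G (insert (wv G c) \<Omega>) K2"
    and spinor1: "spinor K1 X1" and prop1: "propagation G \<theta> D K1 X1"
    and spinor2: "spinor K2 X2" and prop2: "propagation G \<theta> D K2 X2"
    and ident: "cover_identification G c K1 K2 \<iota>"
begin

lemma double_covers: "double_cover G K1" "double_cover G K2"
  using cover1 cover2 by (auto simp: upsilon_cover_def)

lemma around_quad: "lrot K1 (lift3 K1 l) \<noteq> l" "lrot K2 (lift3 K2 l') \<noteq> l'"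
  using cover1 cover2 unfolding upsilon_cover_def lift_defs by blast+

lemma proj_iota: "proj K2 (\<iota> l) = proj K1 l"
  and iota_eq_iff: "\<iota> l = \<iota> l' \<longleftrightarrow> l = l'"
  and iota_lrot: "rot G (proj K1 l) \<noteq> c \<Longrightarrow> \<iota> (lrot K1 l) = lrot K2 (\<iota> l)"
  and iota_lnextf: "proj K1 l \<noteq> c \<Longrightarrow> \<iota> (lnextf K1 l) = lnextf K2 (\<iota> l)"
  using ident by (auto simp: cover_identification_def bij_def inj_eq)

text \<open>
  The form \<open>X\<^sub>1 X\<^sub>2\<close> on corners; the choice of the lift is immaterial since both factors change sign
  with it.
\<close>

definition corner_prod :: "'d \<Rightarrow> real" where
  "corner_prod d = (let l = SOME l. proj K1 l = d in X1 l * X2 (\<iota> l))"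

lemma corner_prod_eq: "corner_prod (proj K1 l) = X1 l * X2 (\<iota> l)"
proof -
  define l' where "l' = (SOME l'. proj K1 l' = proj K1 l)"
  have p: "proj K1 l' = proj K1 l" unfolding l'_def by (rule someI[of _ l]) simp
  have "X1 l' * X2 (\<iota> l') = X1 l * X2 (\<iota> l)"
  proof (cases "l' = l")
    case False
    then have "X1 l' = - X1 l" "X2 (\<iota> l') = - X2 (\<iota> l)"
      using spinor_flip[OF spinor1, of l l'] spinor_flip[OF spinor2, of "\<iota> l" "\<iota> l'"] p
      by (auto simp: proj_iota iota_eq_iff)
    then show ?thesis by simp
  qed simp
  then show ?thesis by (simp add: corner_prod_def l'_def[symmetric])
qed

lemma quad_products:
  assumes "proj K1 l = d" "proj K2 l' = d" "d \<in> D"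
  shows "X1 l * X2 l' + X1 (lift2 K1 l) * X2 (lift2 K2 l')
    = X1 (lift1 K1 l) * X2 (lift1 K2 l') + X1 (lift3 K1 l) * X2 (lift3 K2 l')"
  using propagation_in_quad[OF double_covers(1) around_quad(1) spinor1 prop1, of l]
    propagation_in_quad[OF double_covers(2) around_quad(2) spinor2 prop2, of l'] assms
  by (intro rotated_products[of _ _ "\<theta> d"]) (auto simp: angle_opp opp_in_D)

text \<open>
  Around \<open>v\<close>, the first cover closes up after one turn while the second one does not, so that the
  identification has to fail to respect some step of this turn.
\<close>

lemma iota_last_lrot:
  assumes "proj K1 l = c"
  shows "\<exists>a. rot G (proj K1 a) = c \<and> \<iota> (lrot K1 a) \<noteq> lrot K2 (\<iota> a)"
proof (rule ccontr)
  assume "\<not> ?thesis"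
  then have all: "\<iota> (lrot K1 a) = lrot K2 (\<iota> a)" for a
    using iota_lrot by blast
  have pow: "\<iota> ((lrot K1 ^^ j) l) = (lrot K2 ^^ j) (\<iota> l)" for j
    by (induction j) (auto simp: all)
  let ?n = "card (orbit_of (rot G) c)"
  have "(lrot K1 ^^ ?n) l = l"
    using cover1 finite_orbit assms by (auto simp: upsilon_cover_def)
  moreover have "bv G c \<notin> insert (wv G c) \<Omega>"
    using bv_notin by (auto simp: bv_def wv_def)
  then have "(lrot K2 ^^ ?n) (\<iota> l) \<noteq> \<iota> l"
    using cover2 finite_orbit assms proj_iota[of l] unfolding upsilon_cover_def by metis
  ultimately show False using pow[of ?n] by simp
qed

text \<open>
  The convention on lifts leaves open what happens at the two edges of \<open>z\<^sup>-\<close> at \<open>c\<close>; in fact neither of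
  them is respected.  If the edge from \<open>c\<close> to its successor around \<open>u\<close> were
  respected, then, following the remaining edges of \<open>z\<^sup>-\<close>, so would be the last edge back to \<open>c\<close>, since both
  covers branch around the quad.  But then all steps around \<open>v\<close> would be respected.
\<close>

lemma iota_lnextf_at_c:
  assumes l: "proj K1 l = c"
  shows "\<iota> (lift1 K1 l) \<noteq> lift1 K2 (\<iota> l)"
proof
  assume 1: "\<iota> (lift1 K1 l) = lift1 K2 (\<iota> l)"
  note pr1 = proj_lift[OF double_covers(1), of l] and pr2 = proj_lift[OF double_covers(2), of "\<iota> l"]
  have 2: "\<iota> (lift2 K1 l) = lift2 K2 (\<iota> l)"
    using 1 iota_lrot[of "lift1 K1 l"] pr1 l by (simp add: lift2_def)
  have 3: "\<iota> (lift3 K1 l) = lift3 K2 (\<iota> l)"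
    using 2 iota_lnextf[of "lift2 K1 l"] pr1 l by (simp add: lift3_def)
  let ?b = "lift3 K1 l"
  have eq: "\<iota> (lrot K1 ?b) = lrot K2 (\<iota> ?b)"
    using two_lifts[OF double_covers(2), of "\<iota> (lrot K1 ?b)" "lrot K2 (\<iota> ?b)" "\<iota> l"] 3
      pr1 pr2 around_quad by (auto simp: proj_iota iota_eq_iff)
  obtain a where a: "rot G (proj K1 a) = c" "\<iota> (lrot K1 a) \<noteq> lrot K2 (\<iota> a)"
    using iota_last_lrot[OF l] by blast
  have pb: "proj K1 a = proj K1 ?b"
    by (metis a(1) l pr1(4) double_cover_projs(1)[OF double_covers(1)] rot_eq_iff)
  have ab: "a \<noteq> ?b" using a eq by auto
  have "proj K2 (\<iota> (lrot K1 a)) = c" "proj K2 (lrot K2 (\<iota> a)) = c" "proj K2 (lrot K2 (\<iota> ?b)) = c"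
    using a pb by (auto simp: proj_iota double_cover_projs[OF double_covers(1)] double_cover_projs[OF double_covers(2)])
  then have "\<iota> (lrot K1 a) = lrot K2 (\<iota> ?b)"
    using two_lifts[OF double_covers(2), of "\<iota> (lrot K1 a)" "lrot K2 (\<iota> a)" "lrot K2 (\<iota> ?b)"] a ab
    by (auto simp: iota_eq_iff double_cover_projs[OF double_covers(2)])
  then show False
    using eq ab by (metis iota_eq_iff double_cover_projs(3)[OF double_covers(1)])
qed

text \<open>
  The exterior derivative of the form.  At \<open>z\<^sup>-\<close>, the three other corners of the quad are all identified
  with the opposite lifts relative to \<open>c\<close>, so that the closed relation holds with \<open>-corner_prod c\<close> in place
  of \<open>corner_prod c\<close>.
\<close>

lemma corner_prod_quad:
  assumes "d \<in> D"
  shows "corner_prod d + corner_prod (opp G d) - corner_prod (nextf G d) - corner_prod (nextf G (opp G d))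
    = (if d = c \<or> d = opp G c then 2 * corner_prod c else 0)"
proof -
  have off: "corner_prod d + corner_prod (opp G d) - corner_prod (nextf G d) - corner_prod (nextf G (opp G d)) = 0"
    if "d \<in> D" "d \<noteq> c" "d \<noteq> opp G c" for d
  proof -
    obtain l where l: "proj K1 l = d" using exists_lift[OF double_covers(1)] .
    have neq: "opp G d \<noteq> c" using that by (metis opp_opp)
    note pr = proj_lift[OF double_covers(1), of l, unfolded l]
    have 1: "\<iota> (lift1 K1 l) = lift1 K2 (\<iota> l)"
      using iota_lnextf[of l] l that by (simp add: lift1_def)
    have 2: "\<iota> (lift2 K1 l) = lift2 K2 (\<iota> l)"
      using 1 iota_lrot[of "lift1 K1 l"] pr neq by (simp add: lift2_def)
    have 3: "\<iota> (lift3 K1 l) = lift3 K2 (\<iota> l)"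
      using 2 iota_lnextf[of "lift2 K1 l"] pr neq by (simp add: lift3_def)
    show ?thesis
      using quad_products[OF l _ that(1), of "\<iota> l"] corner_prod_eq[of l] corner_prod_eq[of "lift1 K1 l"]
        corner_prod_eq[of "lift2 K1 l"] corner_prod_eq[of "lift3 K1 l"] pr l 1 2 3 by (simp add: proj_iota)
  qed
  have at: "corner_prod c + corner_prod (opp G c) - corner_prod (nextf G c) - corner_prod (nextf G (opp G c)) = 2 * corner_prod c" if "c \<in> D"
  proof -
    obtain l where l: "proj K1 l = c" using exists_lift[OF double_covers(1)] .
    note pr = proj_lift[OF double_covers(1), of l, unfolded l]
      and pr' = proj_lift[OF double_covers(2), of "\<iota> l", unfolded proj_iota l]
    have 1: "\<iota> (lift1 K1 l) \<noteq> lift1 K2 (\<iota> l)"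
      by (rule iota_lnextf_at_c[OF l])
    have 2: "\<iota> (lift2 K1 l) \<noteq> lift2 K2 (\<iota> l)"
      using 1 iota_lrot[of "lift1 K1 l"] pr
      by (simp add: lift2_def double_cover_projs[OF double_covers(2)])
    have 3: "\<iota> (lift3 K1 l) \<noteq> lift3 K2 (\<iota> l)"
      using 2 iota_lnextf[of "lift2 K1 l"] pr
      by (simp add: lift3_def double_cover_projs[OF double_covers(2)])
    have X: "X2 (\<iota> (lift1 K1 l)) = - X2 (lift1 K2 (\<iota> l))"
      "X2 (\<iota> (lift2 K1 l)) = - X2 (lift2 K2 (\<iota> l))"
      "X2 (\<iota> (lift3 K1 l)) = - X2 (lift3 K2 (\<iota> l))"
      using 1 2 3 pr pr' by (auto intro!: spinor_flip[OF spinor2] simp: proj_iota)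
    show ?thesis
      using quad_products[OF l _ that, of "\<iota> l"] corner_prod_eq[of l] corner_prod_eq[of "lift1 K1 l"]
        corner_prod_eq[of "lift2 K1 l"] corner_prod_eq[of "lift3 K1 l"] pr l X by (simp add: proj_iota)
  qed
  consider "d = c" | "d = opp G c" | "d \<noteq> c" "d \<noteq> opp G c" by blast
  then show ?thesis
  proof cases
    case 2
    then have "c \<in> D" using assms opp_in_D by simp
    then show ?thesis using at 2 by simp
  qed (use at off assms in auto)
qed

definition signed_prod :: "'d \<times> bool \<Rightarrow> real" where
  "signed_prod s = (if snd s then corner_prod (fst s) else - corner_prod (fst s))"

text \<open>
  Stokes' formula: summation by parts moves the difference of the winding numbers across each corner
  to the form; grouping the two darts of each quad yields its derivative in the quad.  The walk may
  traverse \<open>c\<close> itself, in which case \<open>w c\<close> is the winding number at \<open>z\<^sup>-\<close>.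
\<close>

lemma sum_signed_prod:
  assumes "winding_in G D \<gamma> w"
  shows "(\<Sum>s\<leftarrow>\<gamma>. signed_prod s) = of_int (w c) * (2 * corner_prod c)"
proof -
  define B where "B = {d. w d \<noteq> 0}"
  define r where "r = (\<lambda>d. nextf G (opp G d))"
  have finB: "finite B" and BD: "B \<subseteq> D" and wopp: "w (opp G d) = w d" for d
    using assms by (auto simp: winding_in_def B_def)
  have cnt: "real (count_list \<gamma> (d, True)) - real (count_list \<gamma> (d, False))
      = of_int (w d) - of_int (w (rot G d))" for d
  proof -
    have "int (count_list \<gamma> (d, True)) - int (count_list \<gamma> (d, False)) = w d - w (rot G d)"
      using assms by (simp add: winding_in_def)
    then show ?thesis by (metis of_int_diff of_int_of_nat_eq)
  qed
  \<comment> \<open>A finite set of corners outside which all terms below vanish.\<close>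
  define A where "A = fst ` set \<gamma> \<union> B \<union> r ` B"
  have finA: "finite A" using finB by (simp add: A_def)
  have "(\<Sum>s\<leftarrow>\<gamma>. signed_prod s) = (\<Sum>s\<in>A \<times> UNIV. real (count_list \<gamma> s) * signed_prod s)"
    using finA by (intro sum_list_count_real) (force simp: A_def)+
  also have "\<dots> = (\<Sum>d\<in>A. \<Sum>b\<in>UNIV. real (count_list \<gamma> (d, b)) * signed_prod (d, b))"
    by (simp add: sum.cartesian_product)
  also have "\<dots> = (\<Sum>d\<in>A. (of_int (w d) - of_int (w (rot G d))) * corner_prod d)"
    by (intro sum.cong refl) (simp add: UNIV_bool signed_prod_def cnt[symmetric] algebra_simps)
  also have "\<dots> = (\<Sum>d\<in>A. of_int (w d) * corner_prod d) - (\<Sum>d\<in>A. of_int (w (rot G d)) * corner_prod d)"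
    by (simp add: left_diff_distrib sum_subtractf)
  also have "(\<Sum>d\<in>A. of_int (w d) * corner_prod d) = (\<Sum>d\<in>B. of_int (w d) * corner_prod d)"
    using finA by (intro sum.mono_neutral_right) (auto simp: A_def B_def)
  also have "(\<Sum>d\<in>A. of_int (w (rot G d)) * corner_prod d) = (\<Sum>d\<in>r ` B. of_int (w (rot G d)) * corner_prod d)"
  proof (intro sum.mono_neutral_right finA ballI)
    fix d assume "d \<in> A - r ` B"
    then have "rot G d \<notin> B" by (force simp: r_def image_iff)
    then show "of_int (w (rot G d)) * corner_prod d = 0" by (simp add: B_def)
  qed (auto simp: A_def)
  also have "\<dots> = (\<Sum>d\<in>B. of_int (w d) * corner_prod (r d))"
    by (subst sum.reindex) (auto simp: inj_on_def r_def nextf_eq_iff)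
  finally have eq: "(\<Sum>s\<leftarrow>\<gamma>. signed_prod s) = (\<Sum>d\<in>B. of_int (w d) * (corner_prod d - corner_prod (r d)))"
    by (simp add: sum_subtractf right_diff_distrib)
  \<comment> \<open>Each quad is counted twice, once for each of its two darts.\<close>
  have oppB: "bij_betw (opp G) B B"
    by (rule bij_betwI[where g = "opp G"]) (auto simp: B_def wopp)
  have "(\<Sum>d\<in>B. of_int (w d) * (corner_prod d - corner_prod (r d)))
      = (\<Sum>d\<in>B. of_int (w d) * (corner_prod (opp G d) - corner_prod (nextf G d)))"
    by (subst sum.reindex_bij_betw[OF oppB, symmetric]) (simp add: wopp r_def)
  note eq_opp = eq[unfolded this]
  have "2 * (\<Sum>s\<leftarrow>\<gamma>. signed_prod s)
      = (\<Sum>d\<in>B. of_int (w d) * (corner_prod d + corner_prod (opp G d) - corner_prod (nextf G d) - corner_prod (nextf G (opp G d))))"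
    unfolding mult_2
    by (subst eq, subst eq_opp) (simp add: sum.distrib[symmetric] r_def algebra_simps)
  also have "\<dots> = (\<Sum>d\<in>B. of_int (w d) * (if d = c \<or> d = opp G c then 2 * corner_prod c else 0))"
    using BD by (intro sum.cong refl) (subst corner_prod_quad, auto)
  also have "\<dots> = (\<Sum>d\<in>B \<inter> {c, opp G c}. of_int (w d) * (2 * corner_prod c))"
    using finB by (intro sum.mono_neutral_cong_right) auto
  also have "\<dots> = (\<Sum>d\<in>{c, opp G c}. of_int (w d) * (2 * corner_prod c))"
    by (intro sum.mono_neutral_left) (auto simp: B_def)
  also have "\<dots> = 2 * (of_int (w c) * (2 * corner_prod c))"
    by (subst sum.insert) (use opp_neq[of c, symmetric] in \<open>auto simp: wopp\<close>)
  finally show ?thesis by simp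
qed

lemma H_increment:
  assumes "H_along K1 \<iota> X1 X2 \<gamma> h"
  shows "h (length \<gamma>) - h 0 = (\<Sum>s\<leftarrow>\<gamma>. signed_prod s)"
proof -
  have "h (Suc i) - h i = signed_prod (\<gamma> ! i)" if "i < length \<gamma>" for i
  proof -
    obtain l where l: "proj K1 l = fst (\<gamma> ! i)" using exists_lift[OF double_covers(1)] .
    have "if snd (\<gamma> ! i) then h (Suc i) - h i = X1 l * X2 (\<iota> l)
                        else h i - h (Suc i) = X1 l * X2 (\<iota> l)"
      using assms that l by (auto simp: H_along_def)
    then show ?thesis using corner_prod_eq[of l] l by (auto simp: signed_prod_def split: if_splits)
  qed
  then have "(\<Sum>i<length \<gamma>. h (Suc i) - h i) = (\<Sum>i<length \<gamma>. signed_prod (\<gamma> ! i))"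
    by simp
  moreover have "(\<Sum>i<length \<gamma>. signed_prod (\<gamma> ! i)) = (\<Sum>s\<leftarrow>\<gamma>. signed_prod s)"
    by (simp add: sum_list_sum_nth atLeast0LessThan)
  ultimately show ?thesis by (simp add: sum_lessThan_telescope)
qed

end

section \<open>Winding numbers of closed polygons\<close>

lemma pathstart_polyline: "xs \<noteq> [] \<Longrightarrow> pathstart (polyline xs) = hd xs"
  by (induction xs rule: polyline.induct) auto

lemma pathfinish_polyline: "xs \<noteq> [] \<Longrightarrow> pathfinish (polyline xs) = last xs"
  by (induction xs rule: polyline.induct) auto

lemma path_polyline: "path (polyline xs)"
  by (induction xs rule: polyline.induct) (auto simp: pathstart_polyline, simp_all add: path_def)

lemma path_image_polyline:
  assumes "length xs \<ge> 2"
  shows "path_image (polyline xs) = (\<Union>(a, b) \<in> set (zip xs (tl xs)). closed_segment a b)"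
  using assms
proof (induction xs rule: polyline.induct)
  case (3 a b xs)
  show ?case
  proof (cases xs)
    case (Cons y ys)
    then show ?thesis using 3 by (simp add: path_image_join pathstart_polyline)
  qed simp
qed auto

lemma winding_number_polyline:
  assumes "length xs \<ge> 2" and "p \<notin> path_image (polyline xs)"
  shows "winding_number (polyline xs) p
    = (\<Sum>(a, b)\<leftarrow>zip xs (tl xs). winding_number (linepath a b) p)"
  using assms
proof (induction xs rule: polyline.induct)
  case (3 a b xs)
  show ?case
  proof (cases xs)
    case (Cons y ys)
    have "p \<notin> closed_segment a b" "p \<notin> path_image (polyline (b # xs))"
      using 3(3) Cons by (auto simp: path_image_join pathstart_polyline)
    then show ?thesis using 3(1) Cons
      by (simp add: winding_number_join path_polyline pathstart_polyline)
  qed simp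
qed auto

lemma sum_list_telescope:
  fixes g :: "complex \<Rightarrow> complex"
  assumes "xs \<noteq> []"
  shows "(\<Sum>(a, b)\<leftarrow>zip xs (tl xs). g b - g a) = g (last xs) - g (hd xs)"
  using assms by (induction xs rule: polyline.induct) (auto split: if_splits)

lemma segments_of_closed_polygon:
  assumes "ds \<noteq> []" and "\<forall>i < length ds. b (ds ! i) = a (ds ! (Suc i mod length ds))"
  defines "xs \<equiv> map a (ds @ [hd ds])"
  shows "zip xs (tl xs) = map (\<lambda>d. (a d, b d)) ds"
proof (rule nth_equalityI)
  show "length (zip xs (tl xs)) = length (map (\<lambda>d. (a d, b d)) ds)"
    by (simp add: xs_def)
  fix i assume "i < length (zip xs (tl xs))"
  then have i: "i < length ds" by (simp add: xs_def)
  have "tl xs ! i = xs ! Suc i" using i by (intro nth_tl) (simp add: xs_def)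
  also have "\<dots> = b (ds ! i)"
  proof (cases "Suc i < length ds")
    case True
    then show ?thesis using i assms(2) by (simp add: xs_def nth_append)
  next
    case False
    then have "Suc i = length ds" using i by simp
    then show ?thesis using i assms(1,2) by (simp add: xs_def nth_append hd_conv_nth)
  qed
  finally show "zip xs (tl xs) ! i = map (\<lambda>d. (a d, b d)) ds ! i"
    using i by (simp add: xs_def nth_append)
qed

text \<open>
  Comparing winding numbers at two points edge by edge: if the difference is that of a function at the
  ends of the edge up to a correction, only the corrections survive around a closed polygon.
\<close>

lemma winding_number_difference_polygon:
  assumes "ds \<noteq> []" and step: "\<forall>i < length ds. b (ds ! i) = a (ds ! (Suc i mod length ds))"
    and p: "\<And>d. d \<in> set ds \<Longrightarrow> p \<notin> closed_segment (a d) (b d)"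
    and q: "\<And>d. d \<in> set ds \<Longrightarrow> q \<notin> closed_segment (a d) (b d)"
    and diff: "\<And>d. d \<in> set ds \<Longrightarrow> winding_number (linepath (a d) (b d)) p
        - winding_number (linepath (a d) (b d)) q = g (b d) - g (a d) + k d"
  defines "\<gamma> \<equiv> polyline (map a (ds @ [hd ds]))"
  shows "winding_number \<gamma> p - winding_number \<gamma> q = (\<Sum>d\<leftarrow>ds. k d)"
proof -
  define xs where "xs = map a (ds @ [hd ds])"
  have \<gamma>_eq: "\<gamma> = polyline xs" by (simp only: \<gamma>_def xs_def)
  have segs: "zip xs (tl xs) = map (\<lambda>d. (a d, b d)) ds"
    unfolding xs_def by (rule segments_of_closed_polygon[OF assms(1) step])
  have len: "length xs \<ge> 2" using assms(1) by (cases ds) (auto simp: xs_def)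
  have off: "p \<notin> path_image (polyline xs)" "q \<notin> path_image (polyline xs)"
    using p q by (auto simp: path_image_polyline[OF len] segs)
  have "winding_number \<gamma> p - winding_number \<gamma> q
      = (\<Sum>d\<leftarrow>ds. winding_number (linepath (a d) (b d)) p
           - winding_number (linepath (a d) (b d)) q)"
    using winding_number_polyline[OF len off(1)] winding_number_polyline[OF len off(2)]
    by (simp add: segs o_def sum_list_subtractf \<gamma>_eq)
  also have "\<dots> = (\<Sum>d\<leftarrow>ds. g (b d) - g (a d) + k d)"
    using diff by (intro arg_cong[where f = sum_list] map_cong) auto
  also have "\<dots> = (\<Sum>d\<leftarrow>ds. g (b d) - g (a d)) + (\<Sum>d\<leftarrow>ds. k d)"
    by (rule sum_list_addf)
  also have "(\<Sum>d\<leftarrow>ds. g (b d) - g (a d)) = 0"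
    using sum_list_telescope[of xs g] len assms(1)
    by (simp add: segs o_def) (simp add: xs_def hd_map)
  finally show ?thesis by simp
qed

text \<open>
  A primitive of \<open>(1/(z-p) - 1/(z-q)) / (2 \<pi> \<i>)\<close> off the segment from \<open>p\<close> to \<open>q\<close>: by the lemma below, the
  cut of the logarithm is this segment only.
\<close>

definition log_ratio :: "complex \<Rightarrow> complex \<Rightarrow> complex \<Rightarrow> complex" where
  "log_ratio p q z = Ln ((z - p) / (z - q)) / (2 * pi * \<i>)"

lemma ratio_nonpos_imp_closed_segment:
  fixes z p q :: complex
  assumes "z \<noteq> q" and "(z - p) / (z - q) \<in> \<real>\<^sub>\<le>\<^sub>0"
  shows "z \<in> closed_segment p q"
proof -
  obtain r where r: "(z - p) / (z - q) = of_real r" "r \<le> 0"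
    using assms(2) by (auto elim!: nonpos_Reals_cases)
  define u where "u = - r / (1 - r)"
  have u: "0 \<le> u" "u \<le> 1" using r by (auto simp: u_def divide_simps)
  have u': "1 - u = 1 / (1 - r)" using r by (simp add: u_def field_simps)
  have "z - p = of_real r * (z - q)" using r(1) assms(1) nonzero_divide_eq_eq[of "z - q" "z - p"] by auto
  then have "z * (1 - of_real r) = p - of_real r * q" by (simp add: algebra_simps)
  moreover have "(1 - of_real r :: complex) \<noteq> 0" using r
    by (metis eq_iff_diff_eq_0 not_one_le_zero of_real_eq_1_iff)
  ultimately have "z = (p - of_real r * q) / (1 - of_real r)" by (simp add: field_simps)
  also have "\<dots> = (1 - u) *\<^sub>R p + u *\<^sub>R q"
    unfolding u' by (simp add: u_def scaleR_conv_of_real diff_divide_distrib)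
  finally show ?thesis using u by (auto simp: closed_segment_def)
qed

lemma winding_difference_no_crossing:
  assumes "closed_segment a b \<inter> closed_segment p q = {}"
  shows "winding_number (linepath a b) p - winding_number (linepath a b) q
    = log_ratio p q b - log_ratio p q a"
proof -
  have pq: "p \<notin> closed_segment a b" "q \<notin> closed_segment a b"
    using assms by auto
  let ?f = "\<lambda>z. Ln ((z - p) / (z - q))" and ?f' = "\<lambda>z. 1 / (z - p) - 1 / (z - q)"
  have "(?f has_field_derivative ?f' z) (at z within closed_segment a b)"
    if z: "z \<in> closed_segment a b" for z
  proof -
    have "z \<noteq> p" "z \<noteq> q" using pq z by auto
    moreover have "(z - p) / (z - q) \<notin> \<real>\<^sub>\<le>\<^sub>0"
      using ratio_nonpos_imp_closed_segment[of z q p] assms z \<open>z \<noteq> q\<close> by blast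
    ultimately show ?thesis
      by (auto intro!: derivative_eq_intros) (simp add: field_simps)
  qed
  then have "(?f' has_contour_integral (?f b - ?f a)) (linepath a b)"
    using contour_integral_primitive[of "closed_segment a b" ?f ?f' "linepath a b"] by simp
  moreover have "(?f' has_contour_integral (2 * pi * \<i> * winding_number (linepath a b) p
      - 2 * pi * \<i> * winding_number (linepath a b) q)) (linepath a b)"
    using pq by (intro has_contour_integral_diff has_contour_integral_winding_number) auto
  ultimately have "2 * pi * \<i> * winding_number (linepath a b) p
      - 2 * pi * \<i> * winding_number (linepath a b) q = ?f b - ?f a"
    by (rule has_contour_integral_unique[rotated])
  then show ?thesis
    by (simp add: log_ratio_def field_simps)
qed

text \<open>
  In the coordinate \<open>(z - p) / (b - a)\<close> the segment is horizontal and off the real axis, hence off the cut of the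
  principal logarithm.
\<close>

lemma winding_number_linepath_Ln:
  assumes "Im s \<noteq> 0" and "a \<noteq> b" and p: "p = a + s * (b - a)"
  shows "p \<notin> closed_segment a b"
    and "2 * pi * \<i> * winding_number (linepath a b) p = Ln (1 - s) - Ln (- s)"
proof -
  have *: "\<exists>t. (z - p) / (b - a) = of_real t - s \<and> z = a + of_real t * (b - a)"
    if "z \<in> closed_segment a b" for z
  proof -
    obtain t where "z = (1 - t) *\<^sub>R a + t *\<^sub>R b" using \<open>z \<in> _\<close> by (auto simp: closed_segment_def)
    then have t: "z = a + of_real t * (b - a)" by (simp add: scaleR_conv_of_real algebra_simps)
    have "z - p = (of_real t - s) * (b - a)" unfolding t p by (simp add: algebra_simps)
    then show ?thesis using t assms(2) by (intro exI[of _ t]) simp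
  qed
  show p': "p \<notin> closed_segment a b"
  proof
    assume "p \<in> closed_segment a b"
    then obtain t where "(p - p) / (b - a) = complex_of_real t - s" using * by blast
    then have "Im (complex_of_real t - s) = Im 0" by (metis diff_self div_0)
    then show False using assms(1) by simp
  qed
  let ?f = "\<lambda>z. Ln ((z - p) / (b - a))"
  have "(?f has_field_derivative 1 / (z - p)) (at z within closed_segment a b)"
    if z: "z \<in> closed_segment a b" for z
  proof -
    have "z \<noteq> p" using p' z by auto
    moreover have "(z - p) / (b - a) \<notin> \<real>\<^sub>\<le>\<^sub>0"
      using *[OF z] assms(1) by (auto simp: complex_nonpos_Reals_iff)
    ultimately show ?thesis using assms(2)
      by (auto intro!: derivative_eq_intros)
  qed
  then have "((\<lambda>z. 1 / (z - p)) has_contour_integral (?f b - ?f a)) (linepath a b)"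
    using contour_integral_primitive[of "closed_segment a b" ?f "\<lambda>z. 1 / (z - p)" "linepath a b"]
    by simp
  moreover have "((\<lambda>z. 1 / (z - p)) has_contour_integral
      2 * pi * \<i> * winding_number (linepath a b) p) (linepath a b)"
    using p' by (intro has_contour_integral_winding_number) auto
  ultimately have "2 * pi * \<i> * winding_number (linepath a b) p = ?f b - ?f a"
    by (rule has_contour_integral_unique[rotated])
  moreover have "b - p = (1 - s) * (b - a)" "a - p = (- s) * (b - a)"
    unfolding p by (simp_all add: algebra_simps)
  ultimately show "2 * pi * \<i> * winding_number (linepath a b) p = Ln (1 - s) - Ln (- s)"
    using assms(2) by simp
qed

lemma Ln_divide_right_half_plane:
  assumes "0 < Re z" "0 < Re w"
  shows "Ln (z / w) = Ln z - Ln w"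
proof (rule Ln_unique)
  have nz: "z \<noteq> 0" "w \<noteq> 0" using assms by auto
  then show "exp (Ln z - Ln w) = z / w" by (simp add: exp_diff)
  have "\<bar>Im (Ln z)\<bar> < pi / 2" "\<bar>Im (Ln w)\<bar> < pi / 2"
    using Re_Ln_pos_lt nz assms by auto
  then show "- pi < Im (Ln z - Ln w)" "Im (Ln z - Ln w) \<le> pi" by auto
qed

text \<open>
  The points \<open>p\<close> and \<open>q\<close> are mirror images of each other in the line through \<open>a\<close> and \<open>b\<close>, on its left and
  right.  At \<open>b\<close>, the difference of the two logarithms is the principal logarithm of the quotient; at \<open>a\<close> it
  differs from it by \<open>2 \<pi> \<i>\<close> because the arguments of \<open>a - p\<close> and \<open>a - q\<close> lie on different sides of the cut.
\<close>

lemma winding_difference_crossing: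
  assumes "a \<noteq> b" and "0 < r" "r < 1" "0 < y"
    and p: "p = a + Complex r y * (b - a)" and q: "q = a + Complex r (- y) * (b - a)"
  shows "p \<notin> closed_segment a b" and "q \<notin> closed_segment a b"
    and "winding_number (linepath a b) p - winding_number (linepath a b) q
      = log_ratio p q b - log_ratio p q a + 1"
    and "winding_number (linepath b a) p - winding_number (linepath b a) q
      = log_ratio p q a - log_ratio p q b - 1"
proof -
  define s s' where "s = Complex r y" and "s' = Complex r (- y)"
  have im: "Im s \<noteq> 0" "Im s' \<noteq> 0" using assms(4) by (auto simp: s_def s'_def)
  note wp = winding_number_linepath_Ln[OF im(1) assms(1) p[folded s_def]]
    and wq = winding_number_linepath_Ln[OF im(2) assms(1) q[folded s'_def]]
  show off: "p \<notin> closed_segment a b" "q \<notin> closed_segment a b" by (fact wp wq)+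
  have "b - p = (1 - s) * (b - a)" "a - p = (- s) * (b - a)"
    "b - q = (1 - s') * (b - a)" "a - q = (- s') * (b - a)"
    unfolding p q s_def s'_def by (simp_all add: algebra_simps)
  then have rb: "(b - p) / (b - q) = (1 - s) / (1 - s')" and ra: "(a - p) / (a - q) = s / s'"
    using assms(1) by simp_all
  have lb: "log_ratio p q b = (Ln (1 - s) - Ln (1 - s')) / (2 * pi * \<i>)"
    unfolding log_ratio_def rb
    by (subst Ln_divide_right_half_plane) (use assms in \<open>auto simp: s_def s'_def\<close>)
  have la: "log_ratio p q a = (Ln s - Ln s') / (2 * pi * \<i>)"
    unfolding log_ratio_def ra
    by (subst Ln_divide_right_half_plane) (use assms in \<open>auto simp: s_def s'_def\<close>)
  have "Ln (- s) = Ln s - \<i> * pi" "Ln (- s') = Ln s' + \<i> * pi"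
    using assms(2,4) im by (subst Ln_minus; auto simp: s_def s'_def complex_eq_iff)+
  then have "2 * pi * \<i> * (winding_number (linepath a b) p - winding_number (linepath a b) q)
     = (Ln (1 - s) - Ln (1 - s')) - (Ln s - Ln s') + 2 * pi * \<i>"
    unfolding right_diff_distrib wp(2) wq(2) by (simp add: algebra_simps)
  also have "\<dots> = 2 * pi * \<i> * (log_ratio p q b - log_ratio p q a + 1)"
    unfolding lb la distrib_left right_diff_distrib by simp
  finally have "2 * pi * \<i> * (winding_number (linepath a b) p - winding_number (linepath a b) q)
     = 2 * pi * \<i> * (log_ratio p q b - log_ratio p q a + 1)" .
  then show eq: "winding_number (linepath a b) p - winding_number (linepath a b) q
      = log_ratio p q b - log_ratio p q a + 1" by simp
  have "winding_number (linepath b a) x = - winding_number (linepath a b) x"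
    if "x \<notin> closed_segment a b" for x
    using winding_number_reversepath[of "linepath a b" x] that by simp
  then show "winding_number (linepath b a) p - winding_number (linepath b a) q
      = log_ratio p q a - log_ratio p q b - 1"
    using eq off by (simp add: algebra_simps)
qed

section \<open>Rhombi of an isoradial grid\<close>

definition cross :: "complex \<Rightarrow> complex \<Rightarrow> real" where
  "cross a b = Im (cnj a * b)"

lemma cross_self [simp]: "cross a a = 0"
  by (simp add: cross_def)

lemma cross_add: "cross a (x + y) = cross a x + cross a y" "cross (x + y) a = cross x a + cross y a"
  by (simp_all add: cross_def algebra_simps)

lemma cross_scale: "cross a (of_real t * x) = t * cross a x" "cross (of_real t * x) a = t * cross x a"
  by (simp_all add: cross_def algebra_simps)

lemma cross_coordinates:
  assumes "cross f e \<noteq> 0"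
  shows "x = of_real (cross f x / cross f e) * e + of_real (cross x e / cross f e) * f"
proof -
  have "of_real (cross f e) * x = of_real (cross f x) * e + of_real (cross x e) * f"
    by (simp add: cross_def complex_eq_iff algebra_simps)
  then have "x = (of_real (cross f x) * e + of_real (cross x e) * f) / of_real (cross f e)"
    using assms by (simp add: field_simps)
  then show ?thesis by (simp add: add_divide_distrib)
qed

lemma orthogonal_to_basis_imp_zero:
  assumes "Re (cnj x * a) = 0" "Re (cnj x * b) = 0" "Im (cnj a * b) \<noteq> 0"
  shows "x = 0"
proof -
  have "Im (cnj a * b) * Re x = Re (cnj x * a) * Im b - Re (cnj x * b) * Im a"
    "Im (cnj a * b) * Im x = Re (cnj x * b) * Re a - Re (cnj x * a) * Re b"
    by (simp_all add: algebra_simps)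
  then show ?thesis using assms by (auto simp: complex_eq_iff)
qed

text \<open>
  Four equal sides alone allow \<open>g = 0\<close>, or \<open>e = f\<close> with \<open>g\<close> on a circle; the orientation excludes both.
  Then \<open>g - (e + f)\<close> is orthogonal to the two diagonals, which are linearly independent.
\<close>

lemma rhombus_fourth_vertex:
  assumes "norm e = r" "norm f = r" "norm (g - e) = r" "norm (g - f) = r"
    and "0 < Im (cnj g * (e - f))"
  shows "g = e + f" and "0 < cross f e"
proof -
  have "(norm e)\<^sup>2 = (norm f)\<^sup>2" "(norm (g - e))\<^sup>2 = (norm e)\<^sup>2" "(norm (g - f))\<^sup>2 = (norm f)\<^sup>2"
    using assms by auto
  then have "Re (cnj (g - (e + f)) * g) = 0" "Re (cnj (g - (e + f)) * (e - f)) = 0"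
    unfolding cmod_power2 by (simp_all add: power2_eq_square algebra_simps)
  then have "g - (e + f) = 0"
    using assms(5) by (intro orthogonal_to_basis_imp_zero[of _ g "e - f"]) auto
  then show g: "g = e + f" by simp
  show "0 < cross f e" using assms(5) unfolding g cross_def by (simp add: algebra_simps)
qed

lemma rhombus_diagonals_orthogonal:
  assumes "norm e = norm f" and "0 < cross f e"
  obtains y where "0 < y" and "e - f = \<i> * of_real y * (e + f)" and "e + f \<noteq> 0"
proof -
  have nz: "e + f \<noteq> 0"
  proof
    assume "e + f = 0"
    then have "e = - f" by (simp add: add_eq_0_iff)
    then show False using assms(2) by (simp add: cross_def)
  qed
  define y where "y = 2 * cross f e / (norm (e + f))\<^sup>2"
  have "(norm e)\<^sup>2 = (norm f)\<^sup>2" using assms by simp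
  then have "(e - f) * cnj (e + f) = \<i> * of_real (2 * cross f e)"
    unfolding cmod_power2 by (simp add: cross_def complex_eq_iff power2_eq_square algebra_simps)
  then have "(e - f) * (cnj (e + f) * (e + f)) = \<i> * of_real (2 * cross f e) * (e + f)"
    by (metis mult.assoc)
  moreover have norm_sq: "cnj (e + f) * (e + f) = of_real ((norm (e + f))\<^sup>2)"
    by (simp only: complex_norm_square mult.commute)
  ultimately have "(e - f) * of_real ((norm (e + f))\<^sup>2) = \<i> * of_real (2 * cross f e) * (e + f)"
    by (simp only: norm_sq)
  then have "e - f = \<i> * of_real (2 * cross f e) * (e + f) / of_real ((norm (e + f))\<^sup>2)"
    using nz by (simp add: eq_divide_eq del: of_real_power)
  then have "e - f = \<i> * of_real y * (e + f)" by (simp add: y_def)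
  moreover have "0 < y" using nz assms by (simp add: y_def)
  ultimately show ?thesis using that nz by blast
qed

locale isoradial = dart_graph G for G :: "'d emb_graph" +
  fixes pos :: "'d lam_vertex \<Rightarrow> complex" and \<delta> :: real
  assumes grid: "isoradial_grid G pos \<delta>"
begin

abbreviation V :: "'d \<Rightarrow> complex" where "V d \<equiv> pos (bv G d)"
abbreviation U :: "'d \<Rightarrow> complex" where "U d \<equiv> pos (wv G d)"
abbreviation R :: "'d \<Rightarrow> complex set" where "R \<equiv> rhombus G pos"

text \<open>
  The sides of the rhombus of \<open>d\<close> at its black vertex \<open>bv d\<close>; the other two sides are parallel to them.
\<close>

definition side0 :: "'d \<Rightarrow> complex" where "side0 d = U d - V d"
definition side1 :: "'d \<Rightarrow> complex" where "side1 d = U (opp G d) - V d"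

lemma delta_pos: "0 < \<delta>"
  using grid by (simp add: isoradial_grid_def)

lemma norm_side: "norm (U d - V d) = \<delta>"
  using grid by (simp add: isoradial_grid_def dist_norm norm_minus_commute)

lemma rhombus_sides:
  shows "norm (side0 d) = \<delta>" and "norm (side1 d) = \<delta>"
    and "V (opp G d) = V d + side0 d + side1 d"
    and "0 < cross (side1 d) (side0 d)"
proof -
  show n: "norm (side0 d) = \<delta>" by (simp add: norm_side side0_def)
  show n1: "norm (side1 d) = \<delta>"
    using norm_side[of "nextf G (opp G d)"] by (simp add: side1_def)
  let ?g = "V (opp G d) - V d"
  have a: "norm (?g - side0 d) = \<delta>"
    using norm_side[of "nextf G d"] by (simp add: side0_def norm_minus_commute algebra_simps)
  have b: "norm (?g - side1 d) = \<delta>"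
    using norm_side[of "opp G d"] by (simp add: side1_def norm_minus_commute)
  have "0 < Im (cnj ?g * (side0 d - side1 d))"
    using grid by (simp add: isoradial_grid_def side0_def side1_def)
  note fourth = rhombus_fourth_vertex[OF n n1 a b this]
  show "V (opp G d) = V d + side0 d + side1 d" using fourth(1) by (simp add: algebra_simps)
  show "0 < cross (side1 d) (side0 d)" by (rule fourth(2))
qed

lemma U_eq: "U d = V d + side0 d" "U (opp G d) = V d + side1 d"
  by (simp_all add: side0_def side1_def)

text \<open>
  Affine coordinates in which the rhombus of \<open>d\<close> is the unit square with \<open>bv d\<close> at the origin.
\<close>

definition coord0 :: "'d \<Rightarrow> complex \<Rightarrow> real" where
  "coord0 d q = cross (side1 d) (q - V d) / cross (side1 d) (side0 d)"
definition coord1 :: "'d \<Rightarrow> complex \<Rightarrow> real" where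
  "coord1 d q = cross (q - V d) (side0 d) / cross (side1 d) (side0 d)"

lemma coordinates: "q = V d + of_real (coord0 d q) * side0 d + of_real (coord1 d q) * side1 d"
  using cross_coordinates[of "side1 d" "side0 d" "q - V d"] rhombus_sides(4)[of d]
  unfolding coord0_def coord1_def by (simp add: algebra_simps)

lemma coordinates_unique:
  assumes "q = V d + of_real s * side0 d + of_real t * side1 d"
  shows "coord0 d q = s" and "coord1 d q = t"
  using rhombus_sides(4)[of d] unfolding assms coord0_def coord1_def
  by (auto simp: cross_add cross_scale)

lemma continuous_coordinates: "continuous_on S (coord0 d)" "continuous_on S (coord1 d)"
  unfolding coord0_def coord1_def cross_def
  using rhombus_sides(4)[of d] by (intro continuous_intros; simp add: cross_def)+

lemma in_rhombus:
  assumes "0 \<le> coord0 d q" "coord0 d q \<le> 1" "0 \<le> coord1 d q" "coord1 d q \<le> 1"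
  shows "q \<in> R d"
proof -
  let ?s = "coord0 d q" and ?t = "coord1 d q"
  have conv: "convex (R d)" by (simp add: rhombus_def)
  have vert: "V d \<in> R d" "U d \<in> R d" "V (opp G d) \<in> R d" "U (opp G d) \<in> R d"
    unfolding rhombus_def by (auto intro: hull_inc)
  have "(1 - ?s) *\<^sub>R ((1 - ?t) *\<^sub>R V d + ?t *\<^sub>R U (opp G d))
      + ?s *\<^sub>R ((1 - ?t) *\<^sub>R U d + ?t *\<^sub>R V (opp G d)) \<in> R d"
    using assms by (intro convexD[OF conv] vert) auto
  also have "(1 - ?s) *\<^sub>R ((1 - ?t) *\<^sub>R V d + ?t *\<^sub>R U (opp G d))
      + ?s *\<^sub>R ((1 - ?t) *\<^sub>R U d + ?t *\<^sub>R V (opp G d))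
     = V d + of_real ?s * side0 d + of_real ?t * side1 d"
    unfolding rhombus_sides(3) U_eq[of d] by (simp add: scaleR_conv_of_real algebra_simps)
  also have "\<dots> = q" by (rule coordinates[symmetric])
  finally show ?thesis .
qed

lemma in_interior_rhombus:
  assumes "0 < coord0 d q" "coord0 d q < 1" "0 < coord1 d q" "coord1 d q < 1"
  shows "q \<in> interior (R d)"
proof -
  let ?O = "{q. 0 < coord0 d q \<and> coord0 d q < 1 \<and> 0 < coord1 d q \<and> coord1 d q < 1}"
  have "open ?O"
    by (intro open_Collect_conj open_Collect_less continuous_coordinates continuous_intros)
  moreover have "?O \<subseteq> R d" using in_rhombus by force
  ultimately have "?O \<subseteq> interior (R d)" by (simp add: interior_maximal)
  then show ?thesis using assms by auto
qed

lemma closure_interior_rhombus: "closure (interior (R d)) = R d"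
proof -
  define q where "q = V d + of_real (1/2) * side0 d + of_real (1/2) * side1 d"
  have "q \<in> interior (R d)"
    using coordinates_unique[OF q_def] by (intro in_interior_rhombus) auto
  then have "closure (interior (R d)) = closure (R d)"
    by (intro convex_closure_interior) (auto simp: rhombus_def)
  also have "\<dots> = R d"
    by (intro closure_closed compact_imp_closed) (simp add: rhombus_def finite_imp_compact_convex_hull)
  finally show ?thesis .
qed

lemma interior_disjoint_rhombus:
  assumes "e \<noteq> d" "e \<noteq> opp G d"
  shows "interior (R d) \<inter> R e = {}"
proof (rule ccontr)
  assume "interior (R d) \<inter> R e \<noteq> {}"
  then have "interior (R d) \<inter> closure (interior (R e)) \<noteq> {}"
    by (simp add: closure_interior_rhombus)
  then have "interior (R d) \<inter> interior (R e) \<noteq> {}"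
    by (simp add: open_Int_closure_eq_empty)
  then show False using grid assms by (auto simp: isoradial_grid_def)
qed

definition mid :: "'d \<Rightarrow> complex" where
  "mid d = (V d + U d) / 2"

lemma mid_in_quad:
  "mid d = V d + of_real (1/2) * side0 d + of_real 0 * side1 d"
  "mid (nextf G d) = V d + of_real 1 * side0 d + of_real (1/2) * side1 d"
  "mid (nextf G (opp G d)) = V d + of_real 0 * side0 d + of_real (1/2) * side1 d"
  unfolding mid_def by (simp_all add: rhombus_sides(3)[of d] U_eq[of d] add_divide_distrib)

lemma mid_coordinates [simp]:
  "coord0 d (mid d) = 1/2" "coord1 d (mid d) = 0"
  "coord0 (rot G d) (mid d) = 0" "coord1 (rot G d) (mid d) = 1/2"
  using coordinates_unique[OF mid_in_quad(1)[of d]]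
    coordinates_unique[OF mid_in_quad(3)[of "rot G d"]] by auto

lemma on_diagonal:
  shows "q \<in> closed_segment (V d) (V (opp G d)) \<Longrightarrow> coord0 d q = coord1 d q"
    and "q \<in> closed_segment (U d) (U (opp G d)) \<Longrightarrow> coord0 d q + coord1 d q = 1"
proof -
  assume "q \<in> closed_segment (V d) (V (opp G d))"
  then obtain t where "q = (1 - t) *\<^sub>R V d + t *\<^sub>R V (opp G d)"
    by (auto simp: closed_segment_def)
  then have "q = V d + of_real t * side0 d + of_real t * side1 d"
    by (simp add: rhombus_sides(3) scaleR_conv_of_real algebra_simps)
  then show "coord0 d q = coord1 d q" using coordinates_unique by metis
next
  assume "q \<in> closed_segment (U d) (U (opp G d))"
  then obtain t where "q = (1 - t) *\<^sub>R U d + t *\<^sub>R U (opp G d)"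
    by (auto simp: closed_segment_def)
  then have q: "q = V d + of_real (1 - t) * side0 d + of_real t * side1 d"
    by (simp add: U_eq[of d] scaleR_conv_of_real algebra_simps)
  show "coord0 d q + coord1 d q = 1" using coordinates_unique[OF q] by simp
qed

lemma rot_neq: "rot G d \<noteq> d" "rot G d \<noteq> opp G d"
proof -
  have "cross (side1 d) (side0 d) \<noteq> 0" using rhombus_sides(4)[of d] by simp
  moreover have "U d = U (opp G d)" if "rot G d = d"
    using that wv_nextf[of "opp G d"] nextf_eq_iff[of "opp G d" d] by metis
  ultimately show "rot G d \<noteq> d" by (auto simp: side0_def side1_def)
  have "V (opp G d) \<noteq> V d"
    using grid unfolding isoradial_grid_def by (metis complex_cnj_zero diff_self less_irrefl mult_zero_left zero_complex.sel(2))
  then show "rot G d \<noteq> opp G d" using bv_rot[of d] by metis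
qed

text \<open>
  The common side is a coordinate axis for both rhombi, which lie on different sides of it.  As the two
  coordinates transversal to this side have opposite signs, one of them is nonnegative.
\<close>

lemma rhombi_around_mid:
  "mid d \<in> interior (R d \<union> R (rot G d))"
proof -
  let ?r = "rot G d"
  have s: "side1 ?r = side0 d"
    using wv_nextf[of "opp G ?r"] by (simp add: side1_def side0_def)
  let ?O = "{q. 0 < coord0 d q \<and> coord0 d q < 1 \<and> coord1 d q < 1
      \<and> 0 < coord1 ?r q \<and> coord1 ?r q < 1 \<and> coord0 ?r q < 1}"
  have "open ?O"
    by (intro open_Collect_conj open_Collect_less continuous_coordinates continuous_intros)
  moreover have mem: "mid d \<in> ?O"
    by simp
  moreover have "?O \<subseteq> R d \<union> R ?r"
  proof
    fix q assume q: "q \<in> ?O"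
    have "coord1 d q * cross (side1 d) (side0 d) = - (coord0 ?r q * cross (side1 ?r) (side0 ?r))"
      using rhombus_sides(4)[of d] rhombus_sides(4)[of ?r]
      by (simp add: coord1_def coord0_def s) (simp add: cross_def algebra_simps)
    then have "0 \<le> coord1 d q \<or> 0 \<le> coord0 ?r q"
      using rhombus_sides(4)[of d] rhombus_sides(4)[of ?r]
      by (metis linear mult_nonneg_nonneg mult_less_0_iff neg_0_le_iff_le not_le)
    then show "q \<in> R d \<union> R ?r"
      using q in_rhombus[of d q] in_rhombus[of ?r q] by auto
  qed
  ultimately have "?O \<subseteq> interior (R d \<union> R ?r)" by (simp add: interior_maximal)
  then show ?thesis using mem by blast
qed

text \<open>
  Such a rhombus would have interior points near the midpoint, hence common interior points with one of
  the two rhombi that fill a neighbourhood of it.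
\<close>

lemma mid_notin_other_rhombus:
  assumes "e \<noteq> d" "e \<noteq> opp G d" "e \<noteq> rot G d" "e \<noteq> opp G (rot G d)"
  shows "mid d \<notin> R e"
proof
  assume "mid d \<in> R e"
  then have "mid d \<in> closure (interior (R e))" by (simp add: closure_interior_rhombus)
  then have "interior (R d \<union> R (rot G d)) \<inter> interior (R e) \<noteq> {}"
    using rhombi_around_mid[of d] open_Int_closure_eq_empty[OF open_interior] by blast
  then obtain x where x: "x \<in> R d \<union> R (rot G d)" "x \<in> interior (R e)"
    using interior_subset by blast
  have "d \<noteq> opp G e" "rot G d \<noteq> opp G e" using assms by auto
  then show False
    using x interior_disjoint_rhombus[of d e] interior_disjoint_rhombus[of "rot G d" e] assms
    by auto
qed

definition diagonal :: "('d \<Rightarrow> 'd lam_vertex) \<Rightarrow> 'd \<Rightarrow> complex set" where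
  "diagonal e d = closed_segment (pos (e d)) (pos (e (opp G d)))"

lemma diagonal_opp: "diagonal e (opp G d) = diagonal e d"
  by (simp add: diagonal_def closed_segment_commute)

lemma diagonal_subset:
  assumes "e = bv G \<or> e = wv G"
  shows "diagonal e d \<subseteq> R d"
proof -
  have "V d \<in> R d" "U d \<in> R d" "V (opp G d) \<in> R d" "U (opp G d) \<in> R d"
    unfolding rhombus_def by (auto intro: hull_inc)
  moreover have "convex (R d)" by (simp add: rhombus_def)
  ultimately show ?thesis
    using assms closed_segment_subset[of _ "R d"] unfolding diagonal_def by metis
qed

lemma mid_notin_diagonal:
  assumes "e = bv G \<or> e = wv G"
  shows "mid d \<notin> diagonal e x"
proof -
  have own: "mid d \<notin> diagonal e d"
    using assms on_diagonal[of "mid d" d]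
    by (auto simp: diagonal_def)
  have "mid d \<notin> diagonal e (rot G d)"
    using assms on_diagonal[of "mid d" "rot G d"]
    by (auto simp: diagonal_def)
  then show ?thesis
    using own diagonal_opp diagonal_subset[OF assms] mid_notin_other_rhombus[of x d] by blast
qed

text \<open>
  Apart from its ends, the segment between the midpoints of two neighbouring sides is interior to the
  rhombus; it stays strictly on one side of the diagonal that does not separate these midpoints.
\<close>

lemma mid_segment:
  assumes "d' = nextf G d \<or> d' = nextf G (opp G d)"
    and "x \<in> closed_segment (mid d) (mid d')"
  shows "x = mid d \<or> x = mid d' \<or> x \<in> interior (R d)"
    and "d' = nextf G d \<Longrightarrow> coord1 d x < coord0 d x"
    and "d' = nextf G (opp G d) \<Longrightarrow> coord0 d x + coord1 d x < 1"
proof -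
  obtain t where t: "x = (1 - t) *\<^sub>R mid d + t *\<^sub>R mid d'" "0 \<le> t" "t \<le> 1"
    using assms(2) by (auto simp: closed_segment_def)
  have next1: "x = V d + of_real ((1 + t) / 2) * side0 d + of_real (t / 2) * side1 d"
    if "d' = nextf G d"
    unfolding t(1) that mid_in_quad[of d] by (simp add: scaleR_conv_of_real field_simps)
  have next2: "x = V d + of_real ((1 - t) / 2) * side0 d + of_real (t / 2) * side1 d"
    if "d' = nextf G (opp G d)"
    unfolding t(1) that mid_in_quad[of d] by (simp add: scaleR_conv_of_real field_simps)
  show "d' = nextf G d \<Longrightarrow> coord1 d x < coord0 d x"
    using coordinates_unique[OF next1] by simp
  show "coord0 d x + coord1 d x < 1" if "d' = nextf G (opp G d)"
    using coordinates_unique[OF next2[OF that]] by (simp add: diff_divide_distrib)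
  show "x = mid d \<or> x = mid d' \<or> x \<in> interior (R d)"
  proof (cases "t = 0 \<or> t = 1")
    case True
    then show ?thesis using t(1) by auto
  next
    case False
    then have "x \<in> interior (R d)"
      using assms(1) coordinates_unique[OF next1] coordinates_unique[OF next2] t(2,3)
      by (intro in_interior_rhombus) auto
    then show ?thesis by simp
  qed
qed

lemma mid_segment_off_diagonal:
  assumes "e = bv G \<or> e = wv G" and "d' = nextf G d \<or> d' = nextf G (opp G d)"
    and "x \<noteq> d" "x \<noteq> opp G d"
  shows "diagonal e x \<inter> closed_segment (mid d) (mid d') = {}"
  using mid_segment(1)[OF assms(2)] mid_notin_diagonal[OF assms(1)]
    interior_disjoint_rhombus[OF assms(3,4)] diagonal_subset[OF assms(1), of x] by blast

lemma mid_segment_off_own_diagonal: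
  "diagonal (bv G) d \<inter> closed_segment (mid d) (mid (nextf G d)) = {}"
  "diagonal (wv G) d \<inter> closed_segment (mid d) (mid (nextf G (opp G d))) = {}"
proof -
  have "coord0 d x = coord1 d x" if "x \<in> diagonal (bv G) d" for x
    using that on_diagonal(1) unfolding diagonal_def by blast
  then show "diagonal (bv G) d \<inter> closed_segment (mid d) (mid (nextf G d)) = {}"
    using mid_segment(2)[of "nextf G d" d] by (metis disjoint_iff less_irrefl)
  have "coord0 d x + coord1 d x = 1" if "x \<in> diagonal (wv G) d" for x
    using that on_diagonal(2) unfolding diagonal_def by blast
  then show "diagonal (wv G) d \<inter> closed_segment (mid d) (mid (nextf G (opp G d))) = {}"
    using mid_segment(3)[of "nextf G (opp G d)" d] by (metis disjoint_iff less_irrefl)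
qed

end

section \<open>Winding numbers of contours around corners\<close>

context isoradial
begin

lemma contour_geometry:
  assumes E: "e = bv G \<or> e = wv G" and C: "contour_around G pos D c e ds"
  defines "\<gamma> \<equiv> contour_path pos e ds"
  shows "path \<gamma>" and "pathfinish \<gamma> = pathstart \<gamma>"
    and "path_image \<gamma> = (\<Union>x\<in>set ds. diagonal e x)"
    and "mid d \<notin> path_image \<gamma>"
proof -
  define a where "a = (\<lambda>d. pos (e d))"
  have ne: "ds \<noteq> []"
    and step: "\<forall>i<length ds. pos (e (opp G (ds ! i))) = a (ds ! (Suc i mod length ds))"
    using C by (auto simp: contour_around_def contour_def a_def)
  have \<gamma>: "\<gamma> = polyline (map a (ds @ [hd ds]))" by (simp add: \<gamma>_def contour_path_def a_def)
  show "path \<gamma>" unfolding \<gamma> by (rule path_polyline)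
  show "pathfinish \<gamma> = pathstart \<gamma>"
    unfolding \<gamma> using ne by (simp add: pathstart_polyline pathfinish_polyline hd_append hd_map)
  show im: "path_image \<gamma> = (\<Union>x\<in>set ds. diagonal e x)"
    unfolding \<gamma> using ne segments_of_closed_polygon[OF ne step]
    by (subst path_image_polyline) (cases ds, auto simp: diagonal_def a_def)
  show "mid d \<notin> path_image \<gamma>" unfolding im using mid_notin_diagonal[OF E] by auto
qed

text \<open>
  The winding number is an integer by \<open>turns_eq\<close>, so taking the floor of the real part only changes
  its type.
\<close>

definition turns :: "('d \<Rightarrow> 'd lam_vertex) \<Rightarrow> 'd list \<Rightarrow> 'd \<Rightarrow> int" where
  "turns e ds d = \<lfloor>Re (winding_number (contour_path pos e ds) (mid d))\<rfloor>"

lemma turns_eq: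
  assumes "e = bv G \<or> e = wv G" and "contour_around G pos D c e ds"
  shows "of_int (turns e ds d) = winding_number (contour_path pos e ds) (mid d)"
proof -
  have "winding_number (contour_path pos e ds) (mid d) \<in> \<int>"
    using contour_geometry[OF assms] by (intro integer_winding_number)
  then show ?thesis by (auto simp: turns_def elim!: Ints_cases)
qed

lemma turns_along_segment:
  assumes E: "e = bv G \<or> e = wv G" and C: "contour_around G pos D c e ds"
    and d': "d' = nextf G d \<or> d' = nextf G (opp G d)"
    and own: "diagonal e d \<inter> closed_segment (mid d) (mid d') = {}"
    and x: "x \<in> closed_segment (mid d) (mid d')"
  shows "winding_number (contour_path pos e ds) x = of_int (turns e ds d)"
proof -
  note geo = contour_geometry[OF E C]
  have "diagonal e y \<inter> closed_segment (mid d) (mid d') = {}" for y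
    using own diagonal_opp[of e d] mid_segment_off_diagonal[OF E d', of y]
    by (cases "y = d"; cases "y = opp G d") auto
  then have "closed_segment (mid d) (mid d') \<inter> path_image (contour_path pos e ds) = {}"
    unfolding geo(3) by blast
  then show ?thesis
    unfolding turns_eq[OF E C]
    by (intro winding_number_eq[OF geo(1,2), of _ "closed_segment (mid d) (mid d')"] x) auto
qed

text \<open>
  The midpoint itself may lie on the boundary of a rhombus of \<open>D\<close>.  The middle of the segment to a
  neighbouring midpoint is interior to the rhombus of \<open>d\<close>, hence outside all rhombi of \<open>D\<close>, and it has the
  same winding number.
\<close>

lemma turns_zero_outside:
  assumes E: "e = bv G \<or> e = wv G" and C: "contour_around G pos D c e ds"
    and d': "d' = nextf G d \<or> d' = nextf G (opp G d)"
    and own: "diagonal e d \<inter> closed_segment (mid d) (mid d') = {}"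
    and D: "\<forall>d. opp G d \<in> D \<longleftrightarrow> d \<in> D" and "d \<notin> D"
  shows "turns e ds d = 0"
proof -
  define x where "x = (1/2) *\<^sub>R mid d + (1/2) *\<^sub>R mid d'"
  have x: "x \<in> closed_segment (mid d) (mid d')"
    unfolding x_def closed_segment_def by (intro CollectI exI[of _ "1/2"]) simp
  have "mid d' \<noteq> mid d"
    using d' rhombus_sides(4)[of d]
      coordinates_unique[OF mid_in_quad(2)[of d]] coordinates_unique[OF mid_in_quad(3)[of d]]
    by (auto dest!: arg_cong[where f = "coord1 d"])
  then have "x \<noteq> mid d" "x \<noteq> mid d'"
    by (auto simp: x_def scaleR_conv_of_real field_simps)
  then have int: "x \<in> interior (R d)" using mid_segment(1)[OF d' x] by blast
  have "x \<notin> (\<Union>e\<in>D. R e)"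
  proof
    assume "x \<in> (\<Union>e\<in>D. R e)"
    then obtain e where e: "e \<in> D" "x \<in> R e" by auto
    have "e \<noteq> d" "e \<noteq> opp G d" using e \<open>d \<notin> D\<close> D by auto
    then show False using interior_disjoint_rhombus int e by blast
  qed
  then have "winding_number (contour_path pos e ds) x = 0"
    using C by (simp add: contour_around_def)
  then show ?thesis using turns_along_segment[OF E C d' own x] by simp
qed

lemma finite_turns:
  assumes E: "e = bv G \<or> e = wv G" and C: "contour_around G pos D c e ds"
  shows "finite {d. turns e ds d \<noteq> 0}"
proof -
  obtain B where B: "\<forall>z. B \<le> norm z \<longrightarrow> winding_number (contour_path pos e ds) z = 0"
    using winding_number_zero_at_infinity contour_geometry(1,2)[OF E C] by metis
  have "R d \<inter> cball 0 B \<noteq> {}" if "turns e ds d \<noteq> 0" for d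
  proof -
    have "norm (mid d) < B" using B turns_eq[OF E C, of d] that by (metis not_le of_int_eq_0_iff)
    moreover have "mid d \<in> R d" by (intro in_rhombus) auto
    ultimately show ?thesis by force
  qed
  then have "{d. turns e ds d \<noteq> 0} \<subseteq> {d. R d \<inter> cball 0 B \<noteq> {}}" by blast
  moreover have "finite {d. R d \<inter> cball 0 B \<noteq> {}}" using grid by (simp add: isoradial_grid_def)
  ultimately show ?thesis by (rule finite_subset)
qed

text \<open>
  Only the diagonal of the rhombus itself can separate the two midpoints; \<open>d'\<close> is on the left of it
  when it is traversed in the direction of \<open>d\<close>.
\<close>

lemma turns_jump:
  assumes E: "e = bv G \<or> e = wv G" and C: "contour_around G pos D c e ds"
    and quad: "{d', d''} = {d, nextf G d} \<or> {d', d''} = {d, nextf G (opp G d)}"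
    and y: "0 < y" and ne: "pos (e d) \<noteq> pos (e (opp G d))"
    and left: "mid d' = pos (e d) + Complex (1/4) y * (pos (e (opp G d)) - pos (e d))"
    and right: "mid d'' = pos (e d) + Complex (1/4) (- y) * (pos (e (opp G d)) - pos (e d))"
  shows "turns e ds d' - turns e ds d'' = int (count_list ds d) - int (count_list ds (opp G d))"
proof -
  let ?p = "mid d'" and ?q = "mid d''"
  define a where "a = (\<lambda>d. pos (e d))"
  define b where "b = (\<lambda>d. pos (e (opp G d)))"
  \<comment> \<open>The crossing number of a step with the segment between the two midpoints.\<close>
  define k :: "'d \<Rightarrow> complex" where "k = (\<lambda>x. of_bool (x = d) - of_bool (x = opp G d))"
  note cross = winding_difference_crossing[OF ne _ _ y left right]
  have ds: "ds \<noteq> []" "\<forall>i<length ds. b (ds ! i) = a (ds ! (Suc i mod length ds))"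
    using C by (auto simp: contour_around_def contour_def a_def b_def)
  have off: "?p \<notin> closed_segment (a x) (b x)" "?q \<notin> closed_segment (a x) (b x)" for x
    using mid_notin_diagonal[OF E] unfolding a_def b_def diagonal_def by auto
  have "winding_number (linepath (a x) (b x)) ?p - winding_number (linepath (a x) (b x)) ?q
      = log_ratio ?p ?q (b x) - log_ratio ?p ?q (a x) + k x" for x
  proof -
    consider "x = d" | "x = opp G d" | "x \<noteq> d" "x \<noteq> opp G d" by blast
    then show ?thesis
    proof cases
      case 1
      then show ?thesis using cross(3) opp_neq[of d, symmetric] by (simp add: a_def b_def k_def)
    next
      case 2
      then show ?thesis using cross(4) by (simp add: a_def b_def k_def)
    next
      case 3
      have off: "diagonal e x \<inter> closed_segment (mid d) (mid d0) = {}"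
        if "d0 = nextf G d \<or> d0 = nextf G (opp G d)" for d0
        by (rule mid_segment_off_diagonal[OF E that 3])
      obtain d0 where "d0 = nextf G d \<or> d0 = nextf G (opp G d)"
        "(d' = d \<and> d'' = d0) \<or> (d' = d0 \<and> d'' = d)"
        using quad by (auto simp: doubleton_eq_iff)
      then have "diagonal e x \<inter> closed_segment ?p ?q = {}"
        using off[of d0] closed_segment_commute by metis
      then show ?thesis
        using winding_difference_no_crossing[of "a x" "b x" ?p ?q] 3
        by (simp add: a_def b_def k_def diagonal_def)
    qed
  qed
  then have "winding_number (contour_path pos e ds) ?p - winding_number (contour_path pos e ds) ?q
      = (\<Sum>x\<leftarrow>ds. k x)"
    using winding_number_difference_polygon[OF ds off, where g = "log_ratio ?p ?q" and k = k]
    by (simp add: contour_path_def a_def)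
  also have "\<dots> = of_nat (count_list ds d) - of_nat (count_list ds (opp G d))"
    by (induction ds) (auto simp: k_def)
  finally have "of_int (turns e ds d' - turns e ds d'')
      = (of_int (int (count_list ds d) - int (count_list ds (opp G d))) :: complex)"
    by (simp add: turns_eq[OF E C])
  then show ?thesis by (simp only: of_int_eq_iff)
qed

text \<open>
  The midpoints of the corners \<open>d\<close> and \<open>nextf d\<close> are on the same side of the black diagonal (at the white
  vertex \<open>wv d\<close>, on the left), and that of \<open>nextf (opp d)\<close> is the mirror image of the first.  The segment
  between mirror images meets the diagonal at a quarter of its length.
\<close>

lemma
  assumes C: "contour_around G pos D c (bv G) ds"
  shows turns_black_same_side: "turns (bv G) ds (nextf G d) = turns (bv G) ds d"
    and turns_black_jump: "turns (bv G) ds d - turns (bv G) ds (nextf G (opp G d))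
      = int (count_list ds d) - int (count_list ds (opp G d))"
proof -
  have "winding_number (contour_path pos (bv G) ds) (mid (nextf G d)) = of_int (turns (bv G) ds d)"
    by (rule turns_along_segment[OF _ C _ mid_segment_off_own_diagonal(1)]) auto
  then show "turns (bv G) ds (nextf G d) = turns (bv G) ds d"
    using turns_eq[OF _ C, of "nextf G d"] by simp
  obtain y where y: "0 < y" "side0 d - side1 d = \<i> * of_real y * (side0 d + side1 d)"
    "side0 d + side1 d \<noteq> 0"
    using rhombus_diagonals_orthogonal[of "side0 d" "side1 d"] rhombus_sides[of d] by metis
  have b: "V (opp G d) - V d = side0 d + side1 d" by (simp add: rhombus_sides(3))
  have C4: "Complex (1/4) (t/4) * z = (z + \<i> * of_real t * z) / 4"
    "Complex (1/4) (- (t/4)) * z = (z - \<i> * of_real t * z) / 4" for t z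
    by (simp_all add: Complex_eq field_simps)
  show "turns (bv G) ds d - turns (bv G) ds (nextf G (opp G d))
      = int (count_list ds d) - int (count_list ds (opp G d))"
  proof (rule turns_jump[OF _ C])
    show "0 < y / 4" using y by simp
    show "V d \<noteq> V (opp G d)" using b y(3) by auto
    show "mid d = V d + Complex (1/4) (y/4) * (V (opp G d) - V d)"
      unfolding b C4 y(2)[symmetric] by (simp add: mid_in_quad(1)[of d] field_simps)
    show "mid (nextf G (opp G d)) = V d + Complex (1/4) (- (y/4)) * (V (opp G d) - V d)"
      unfolding b C4 y(2)[symmetric] by (simp add: mid_in_quad(3)[of d] field_simps)
  qed auto
qed

text \<open>
  For white diagonals, it is the black vertex that two corners on the same side share, and \<open>nextf d\<close> is
  on the left.
\<close>

lemma
  assumes C: "contour_around G pos D c (wv G) ds"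
  shows turns_white_same_side: "turns (wv G) ds (nextf G (opp G d)) = turns (wv G) ds d"
    and turns_white_jump: "turns (wv G) ds (nextf G d) - turns (wv G) ds d
      = int (count_list ds d) - int (count_list ds (opp G d))"
proof -
  have "winding_number (contour_path pos (wv G) ds) (mid (nextf G (opp G d)))
      = of_int (turns (wv G) ds d)"
    by (rule turns_along_segment[OF _ C _ mid_segment_off_own_diagonal(2)]) auto
  then show "turns (wv G) ds (nextf G (opp G d)) = turns (wv G) ds d"
    using turns_eq[OF _ C, of "nextf G (opp G d)"] by simp
  obtain y where y: "0 < y" "side0 d - side1 d = \<i> * of_real y * (side0 d + side1 d)"
    "side0 d + side1 d \<noteq> 0"
    using rhombus_diagonals_orthogonal[of "side0 d" "side1 d"] rhombus_sides[of d] by metis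
  have b: "U (opp G d) - U d = side1 d - side0 d" by (simp add: side0_def side1_def)
  have y': "\<i> * of_real (1 / y) * (side1 d - side0 d) = side0 d + side1 d"
    using y(1) arg_cong[OF y(2), of "\<lambda>z. - \<i> * of_real (1 / y) * z"]
    by (simp add: field_simps)
  have C4: "Complex (1/4) (t/4) * z = (z + \<i> * of_real t * z) / 4"
    "Complex (1/4) (- (t/4)) * z = (z - \<i> * of_real t * z) / 4" for t z
    by (simp_all add: Complex_eq field_simps)
  show "turns (wv G) ds (nextf G d) - turns (wv G) ds d
      = int (count_list ds d) - int (count_list ds (opp G d))"
  proof (rule turns_jump[OF _ C])
    show "0 < 1 / y / 4" using y by simp
    have "side1 d - side0 d \<noteq> 0" using y' y(3) by auto
    then show "U d \<noteq> U (opp G d)" using b by auto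
    show "mid (nextf G d) = U d + Complex (1/4) (1/y/4) * (U (opp G d) - U d)"
      unfolding b C4 y' by (simp add: mid_in_quad(2)[of d] U_eq(1)[of d] field_simps)
    show "mid d = U d + Complex (1/4) (- (1/y/4)) * (U (opp G d) - U d)"
      unfolding b C4 y' by (simp add: mid_in_quad(1)[of d] U_eq(1)[of d] field_simps)
  qed auto
qed

lemma turns_at_corner:
  assumes "contour_around G pos D c e ds"
  shows "turns e ds c = 1"
  using assms by (simp add: turns_def contour_around_def mid_def)

end

section \<open>Massive s-holomorphic functions in one rhombus\<close>

text \<open>
  Multiplying the projection by \<open>cnj \<eta>\<close> turns it into the real part of \<open>F cnj \<eta>\<close>.
\<close>

lemma Pr_eq_multiple:
  assumes "norm \<eta> = 1" and "Pr F \<eta> = of_real k * \<eta> * of_real x"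
  shows "Re (F * cnj \<eta>) = k * x"
proof -
  have \<eta>: "\<eta> * cnj \<eta> = 1" using complex_norm_square[of \<eta>] assms(1) by simp
  have "Pr F \<eta> * cnj \<eta> = (F * cnj \<eta> + cnj (F * cnj \<eta>) * (\<eta> * cnj \<eta>)) / 2"
    by (simp add: Pr_def power2_eq_square algebra_simps)
  also have "\<dots> = of_real (Re (F * cnj \<eta>))" unfolding \<eta> by (simp add: complex_eq_iff)
  also have "Pr F \<eta> * cnj \<eta> = of_real (k * x) * (\<eta> * cnj \<eta>)" unfolding assms(2) by simp
  finally show ?thesis unfolding \<eta> by (simp only: mult_1_right of_real_eq_iff)
qed

lemma cis_shift: "cis (x + pi / 2) = \<i> * cis x" "cis (x + pi) = - cis x" "cis (x + 2 * pi) = cis x"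
  by (auto simp: complex_eq_iff sin_add cos_add)

text \<open>
  With \<open>P = f\<^sub>1 f\<^sub>2\<close>, the components yield the real parts of \<open>P cis t\<close> and \<open>P cis (-t)\<close>, whose sum and
  difference are \<open>2 cos t Re P\<close> and \<open>-2 sin t Im P\<close>.
\<close>

lemma product_of_components:
  fixes f1 f2 :: complex and t :: real
  assumes "x0 = Re (f1 * cis (t/2))" "x1 = - Im (f1 * cis (- (t/2)))"
    and "x2 = - Im (f1 * cis (t/2))" "x3 = - Re (f1 * cis (- (t/2)))"
    and "y0 = Re (f2 * cis (t/2))" "y1 = - Im (f2 * cis (- (t/2)))"
    and "y2 = - Im (f2 * cis (t/2))" "y3 = - Re (f2 * cis (- (t/2)))"
  shows "2 * cos t * Re (f1 * f2) = x0 * y0 - x2 * y2 + x3 * y3 - x1 * y1"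
    and "2 * sin t * Im (f1 * f2) = x3 * y3 - x1 * y1 - x0 * y0 + x2 * y2"
proof -
  have "cis (t/2) * cis (t/2) = cis t" "cis (- (t/2)) * cis (- (t/2)) = cis (- t)"
    by (simp_all add: cis_mult)
  then have "f1 * f2 * cis t = (f1 * cis (t/2)) * (f2 * cis (t/2))"
    "f1 * f2 * cis (- t) = (f1 * cis (- (t/2))) * (f2 * cis (- (t/2)))"
    by (metis mult.assoc mult.left_commute)+
  then have "Re (f1 * f2 * cis t) = Re ((f1 * cis (t/2)) * (f2 * cis (t/2)))"
    "Re (f1 * f2 * cis (- t)) = Re ((f1 * cis (- (t/2))) * (f2 * cis (- (t/2))))"
    by (simp_all only:)
  moreover have "Re (a * b) = Re a * Re b - (- Im a) * (- Im b)"
    "Re (a * b) = (- Re a) * (- Re b) - (- Im a) * (- Im b)" for a b :: complex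
    by simp_all
  ultimately have *: "Re (f1 * f2 * cis t) = x0 * y0 - x2 * y2"
    "Re (f1 * f2 * cis (- t)) = x3 * y3 - x1 * y1"
    unfolding assms by metis+
  have "2 * cos t * Re (f1 * f2) = Re (f1 * f2 * cis t) + Re (f1 * f2 * cis (- t))"
    "2 * sin t * Im (f1 * f2) = Re (f1 * f2 * cis (- t)) - Re (f1 * f2 * cis t)"
    by (simp_all add: algebra_simps)
  then show "2 * cos t * Re (f1 * f2) = x0 * y0 - x2 * y2 + x3 * y3 - x1 * y1"
    "2 * sin t * Im (f1 * f2) = x3 * y3 - x1 * y1 - x0 * y0 + x2 * y2"
    unfolding * by auto
qed

context isoradial
begin

abbreviation half_ang :: "'d \<Rightarrow> real" where "half_ang \<equiv> half_angle G pos"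

lemma half_angle_bounds: "0 < half_ang d" "half_ang d < pi / 2"
  and side0_eq_rotated_side1: "side0 d = side1 d * cis (2 * half_ang d)"
proof -
  let ?w = "side0 d / side1 d"
  have nz: "side1 d \<noteq> 0" using rhombus_sides(2)[of d] delta_pos by auto
  have w: "?w * of_real (\<delta>\<^sup>2) = side0 d * cnj (side1 d)"
    using complex_norm_square[of "side1 d"] nz by (simp add: rhombus_sides(2))
  have "Im (z * of_real r) = Im z * r" for z r by simp
  then have "Im ?w * \<delta>\<^sup>2 = cross (side1 d) (side0 d)"
    using w unfolding cross_def by (metis mult.commute)
  then have "0 < Im ?w"
    using rhombus_sides(4)[of d] delta_pos by (metis zero_less_mult_pos2 zero_less_power)
  then have "0 < Arg ?w \<and> Arg ?w < pi" using Arg_lt_pi by simp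
  then show "0 < half_ang d" "half_ang d < pi / 2"
    by (simp_all add: half_angle_def side0_def side1_def)
  have "norm ?w = 1" using rhombus_sides(1,2)[of d] delta_pos by (simp add: norm_divide)
  then have "?w = cis (Arg ?w)" using rcis_cmod_Arg[of ?w] by (simp only: rcis_def of_real_1 mult_1)
  then show "side0 d = side1 d * cis (2 * half_ang d)"
    using nz by (simp add: half_angle_def side0_def side1_def field_simps)
qed

lemma sides_of_direction:
  assumes "sgn (V d - center G pos d) = cis \<beta>"
  shows "side1 d = - (of_real \<delta> * cis (\<beta> - half_ang d))"
    and "side0 d = - (of_real \<delta> * cis (\<beta> + half_ang d))"
proof -
  let ?t = "half_ang d"
  have cp: "cos ?t > 0" using half_angle_bounds[of d] by (intro cos_gt_zero_pi) auto
  have "cis (2 * ?t) = cis ?t * cis ?t" by (simp add: cis_mult)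
  moreover have "1 = cis ?t * cis (- ?t)" by (simp add: cis_mult)
  ultimately have "1 + cis (2 * ?t) = cis ?t * (cis (- ?t) + cis ?t)" by (simp only: distrib_left)
  also have "\<dots> = cis ?t * of_real (2 * cos ?t)"
    by (intro arg_cong2[where f = "(*)"]) (auto simp: complex_eq_iff)
  finally have one: "1 + cis (2 * ?t) = cis ?t * of_real (2 * cos ?t)" .
  have "V d - center G pos d = - ((side0 d + side1 d) / 2)"
    unfolding center_def rhombus_sides(3)[of d] by (simp add: field_simps)
  also have "side0 d + side1 d = side1 d * (1 + cis (2 * ?t))"
    unfolding side0_eq_rotated_side1[of d] by (simp add: algebra_simps)
  finally have z: "V d - center G pos d = of_real (cos ?t) * (- side1 d * cis ?t)"
    unfolding one by simp
  have "sgn (V d - center G pos d) = sgn (- side1 d * cis ?t)"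
    unfolding z using cp by (simp add: sgn_mult sgn_of_real)
  also have "\<dots> = - side1 d * cis ?t / of_real \<delta>"
    by (simp add: sgn_eq norm_mult rhombus_sides(2))
  finally have "cis \<beta> = - side1 d * cis ?t / of_real \<delta>" using assms by simp
  then have "of_real \<delta> * cis \<beta> * cis (- ?t) = - side1 d * (cis ?t * cis (- ?t))"
    using delta_pos by (simp add: field_simps)
  then have s1: "of_real \<delta> * cis (\<beta> - ?t) = - side1 d" by (simp add: cis_mult mult.assoc)
  then show "side1 d = - (of_real \<delta> * cis (\<beta> - ?t))" by simp
  then show "side0 d = - (of_real \<delta> * cis (\<beta> + ?t))"
    unfolding side0_eq_rotated_side1[of d] by (simp add: cis_mult mult.assoc add.commute)
qed

text \<open>
  The sides of the rhombus in terms of \<open>arg (v\<^sub>0 - z)\<close>; this determines which of the two signs in the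
  definition of \<open>\<eta>\<close> applies at each of the four corners.
\<close>

lemma corner_directions:
  assumes "sgn (V d - center G pos d) = cis \<beta>"
  shows "sgn (V d - U d) = cis (\<beta> + half_ang d)"
    and "sgn (V (nextf G d) - U (nextf G d)) = cis (\<beta> + pi - half_ang d)"
    and "sgn (V (opp G d) - U (opp G d)) = cis (\<beta> + pi + half_ang d)"
    and "sgn (V (nextf G (opp G d)) - U (nextf G (opp G d))) = cis (\<beta> + 2 * pi - half_ang d)"
proof -
  have sg: "sgn (of_real \<delta> * cis x) = cis x" for x
    using delta_pos by (simp add: sgn_mult sgn_of_real sgn_cis)
  have shift: "cis (\<beta> + pi - half_ang d) = - cis (\<beta> - half_ang d)"
    "cis (\<beta> + pi + half_ang d) = - cis (\<beta> + half_ang d)"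
    "cis (\<beta> + 2 * pi - half_ang d) = cis (\<beta> - half_ang d)"
    using cis_shift(2)[of "\<beta> - half_ang d"] cis_shift(2)[of "\<beta> + half_ang d"]
      cis_shift(3)[of "\<beta> - half_ang d"] by (simp_all add: algebra_simps)
  note sides = sides_of_direction[OF assms]
  have "V d - U d = of_real \<delta> * cis (\<beta> + half_ang d)"
    "V (nextf G d) - U (nextf G d) = - (of_real \<delta> * cis (\<beta> - half_ang d))"
    "V (opp G d) - U (opp G d) = - (of_real \<delta> * cis (\<beta> + half_ang d))"
    "V (nextf G (opp G d)) - U (nextf G (opp G d)) = of_real \<delta> * cis (\<beta> - half_ang d)"
    by (simp_all add: rhombus_sides(3)[of d] U_eq[of d] sides)
  then show "sgn (V d - U d) = cis (\<beta> + half_ang d)"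
    "sgn (V (nextf G d) - U (nextf G d)) = cis (\<beta> + pi - half_ang d)"
    "sgn (V (opp G d) - U (opp G d)) = cis (\<beta> + pi + half_ang d)"
    "sgn (V (nextf G (opp G d)) - U (nextf G (opp G d))) = cis (\<beta> + 2 * pi - half_ang d)"
    unfolding shift by (simp_all only: sg sgn_minus)
qed

text \<open>
  Up to normalization, \<open>F\<close> is rotated by \<open>\<beta>/2 - \<pi>/4\<close>, which makes the four directions depend on \<open>\<theta>\<close> only:
  they are \<open>\<plusminus>\<theta>/2\<close>, shifted by the multiples of \<open>\<pi>/2\<close> due to the branch of the argument at each corner.
\<close>

lemma s_hol_value_components:
  assumes K: "double_cover G K" and l: "proj K l = d"
    and \<beta>: "sgn (V d - center G pos d) = cis \<beta>"
    and F: "s_hol_value G pos \<delta> \<theta> K X l \<beta> F"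
  defines "f \<equiv> of_real (\<delta> powr (1/2)) * (F * cis (\<beta>/2 - pi/4))" and "t \<equiv> \<theta> d"
  shows "X l = Re (f * cis (t/2))" and "X (lift1 K l) = - Im (f * cis (- (t/2)))"
    and "X (lift2 K l) = - Im (f * cis (t/2))" and "X (lift3 K l) = - Re (f * cis (- (t/2)))"
proof -
  note pr = proj_lift[OF K, of l, unfolded l] and dir = corner_directions[OF \<beta>]
  have dd: "\<delta> powr (1/2) * \<delta> powr (- 1/2) = 1"
    using delta_pos by (simp add: powr_add[symmetric])
  have main: "X (quad_lift K l ! j)
      = \<delta> powr (1/2) * Re (F * (cis (- (pi / 4)) * cis (([\<beta>, \<beta> + pi, \<beta> + pi, \<beta> + 2 * pi] ! j + s * t) / 2)))"
    if "j < 4" "s \<in> {1, - 1}"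
      and "sgn (V (proj K (quad_lift K l ! j)) - U (proj K (quad_lift K l ! j)))
        = cis ([\<beta>, \<beta> + pi, \<beta> + pi, \<beta> + 2 * pi] ! j + s * half_ang d)" for j s
  proof -
    let ?a = "[\<beta>, \<beta> + pi, \<beta> + pi, \<beta> + 2 * pi] ! j"
    let ?\<eta> = "cis (pi / 4) * cis (- (?a + s * t) / 2)"
    have "Pr F ?\<eta> = of_real (\<delta> powr (- 1 / 2)) * ?\<eta> * of_real (X (quad_lift K l ! j))"
      using F that unfolding s_hol_value_def Let_def l t_def by blast
    then have "Re (F * cnj ?\<eta>) = \<delta> powr (- 1 / 2) * X (quad_lift K l ! j)"
      by (intro Pr_eq_multiple) (simp_all add: norm_mult)
    then have "\<delta> powr (1/2) * Re (F * cnj ?\<eta>) = X (quad_lift K l ! j)"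
      using dd by (simp add: mult.assoc[symmetric])
    moreover have "cnj (cis (pi / 4) * cis (- x / 2)) = cis (- (pi / 4)) * cis (x / 2)" for x
      by (simp add: cis_cnj)
    ultimately show ?thesis by metis
  qed
  have Re_f: "Re (f * z) = \<delta> powr (1/2) * Re (F * (cis (\<beta>/2 - pi/4) * z))"
    "Im (f * z) = \<delta> powr (1/2) * Im (F * (cis (\<beta>/2 - pi/4) * z))" for z
    unfolding f_def mult.assoc by (simp_all only: Re_complex_of_real Im_complex_of_real
      times_complex.sel mult_zero_left diff_zero add_0_right add_0_left)
  have "X l = \<delta> powr (1/2) * Re (F * cis (\<beta>/2 - pi/4 + t/2))"
    using main[of 0 1] dir(1) l
    by (simp add: lift_quad_lift cis_mult add_divide_distrib algebra_simps)
  then show "X l = Re (f * cis (t/2))"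
    unfolding Re_f by (simp add: cis_mult)
  have "X (lift1 K l) = \<delta> powr (1/2) * Re (F * cis ((\<beta>/2 - pi/4 - t/2) + pi/2))"
    using main[of 1 "-1"] dir(2) pr
    by (simp add: lift_quad_lift cis_mult field_simps)
  then show "X (lift1 K l) = - Im (f * cis (- (t/2)))"
    unfolding Re_f cis_shift by (simp add: cis_mult algebra_simps)
  have "X (lift2 K l) = \<delta> powr (1/2) * Re (F * cis ((\<beta>/2 - pi/4 + t/2) + pi/2))"
    using main[of 2 1] dir(3) pr
    by (simp add: lift_quad_lift cis_mult add_divide_distrib algebra_simps)
  then show "X (lift2 K l) = - Im (f * cis (t/2))"
    unfolding Re_f cis_shift by (simp add: cis_mult algebra_simps)
  have "X (lift3 K l) = \<delta> powr (1/2) * Re (F * cis ((\<beta>/2 - pi/4 - t/2) + pi))"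
    using main[of 3 "-1"] dir(4) pr
    by (simp add: lift_quad_lift cis_mult field_simps numeral_3_eq_3)
  then show "X (lift3 K l) = - Re (f * cis (- (t/2)))"
    unfolding Re_f cis_shift by (simp add: cis_mult algebra_simps)
qed

text \<open>
  The diagonals have lengths \<open>2 \<delta> cos\<close> and \<open>2 \<delta> sin\<close> of the half-angle of the rhombus, which cancels the
  denominators; the numerators \<open>cos \<theta>\<close> and \<open>sin \<theta>\<close> are those in \<open>product_of_components\<close>.
\<close>

lemma integrand_black_white:
  assumes K: "double_cover G K1" "double_cover G K2" and l: "proj K1 l1 = d" "proj K2 l2 = d"
    and \<beta>: "sgn (V d - center G pos d) = cis \<beta>"
    and F: "s_hol_value G pos \<delta> \<theta> K1 X1 l1 \<beta> F1" "s_hol_value G pos \<delta> \<theta> K2 X2 l2 \<beta> F2"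
  defines "p0 \<equiv> X1 l1 * X2 l2" and "p1 \<equiv> X1 (lift1 K1 l1) * X2 (lift1 K2 l2)"
    and "p2 \<equiv> X1 (lift2 K1 l1) * X2 (lift2 K2 l2)" and "p3 \<equiv> X1 (lift3 K1 l1) * X2 (lift3 K2 l2)"
  shows "cos (\<theta> d) / cos (half_ang d) * (1/2 * Im (F1 * F2 * (V (opp G d) - V d)))
      = (p1 + p2 - p0 - p3) / 2"
    and "sin (\<theta> d) / sin (half_ang d) * (1/2 * Im (F1 * F2 * (U (opp G d) - U d)))
      = (p0 + p1 - p2 - p3) / 2"
proof -
  let ?t = "half_ang d"
  define f where "f = (\<lambda>F. of_real (\<delta> powr (1/2)) * (F * cis (\<beta>/2 - pi/4)))"
  have f_app: "f F = of_real (\<delta> powr (1/2)) * (F * cis (\<beta>/2 - pi/4))" for F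
    by (simp add: f_def)
  note comp1 = s_hol_value_components[OF K(1) l(1) \<beta> F(1), folded f_app]
    and comp2 = s_hol_value_components[OF K(2) l(2) \<beta> F(2), folded f_app]
  note products = product_of_components[OF comp1 comp2, folded p0_def p1_def p2_def p3_def]
  have "\<delta> powr (1/2) * \<delta> powr (1/2) = \<delta>" using delta_pos by (simp add: powr_add[symmetric])
  then have dd: "complex_of_real (\<delta> powr (1/2)) * of_real (\<delta> powr (1/2)) = of_real \<delta>"
    by (metis of_real_mult)
  have "cis (\<beta>/2 - pi/4) * cis (\<beta>/2 - pi/4) = cis (\<beta> - pi/2)" by (simp add: cis_mult)
  also have "\<dots> = - \<i> * cis \<beta>" by (simp add: complex_eq_iff cos_diff sin_diff)
  finally have cc: "cis (\<beta>/2 - pi/4) * cis (\<beta>/2 - pi/4) = - \<i> * cis \<beta>" .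
  have "f F1 * f F2 = (of_real (\<delta> powr (1/2)) * of_real (\<delta> powr (1/2)))
      * (cis (\<beta>/2 - pi/4) * cis (\<beta>/2 - pi/4)) * (F1 * F2)"
    unfolding f_app by (simp only: ac_simps)
  also have "\<dots> = - \<i> * (F1 * F2 * (of_real \<delta> * cis \<beta>))"
    unfolding dd cc by (simp only: ac_simps)
  finally have ff: "F1 * F2 * (of_real \<delta> * cis \<beta>) = \<i> * (f F1 * f F2)"
    by (simp add: mult.assoc[symmetric])
  note sides = sides_of_direction[OF \<beta>]
  have "cis (\<beta> - ?t) + cis (\<beta> + ?t) = of_real (2 * cos ?t) * cis \<beta>"
    "cis (\<beta> + ?t) - cis (\<beta> - ?t) = of_real (2 * sin ?t) * (\<i> * cis \<beta>)"
    by (simp_all add: complex_eq_iff cos_add cos_diff sin_add sin_diff)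
  moreover have "V (opp G d) - V d = - (of_real \<delta> * (cis (\<beta> - ?t) + cis (\<beta> + ?t)))"
    "U (opp G d) - U d = of_real \<delta> * (cis (\<beta> + ?t) - cis (\<beta> - ?t))"
    by (simp_all add: rhombus_sides(3)[of d] U_eq[of d] sides algebra_simps)
  ultimately have "F1 * F2 * (V (opp G d) - V d) = - of_real (2 * cos ?t) * (F1 * F2 * (of_real \<delta> * cis \<beta>))"
    "F1 * F2 * (U (opp G d) - U d) = of_real (2 * sin ?t) * (\<i> * (F1 * F2 * (of_real \<delta> * cis \<beta>)))"
    by simp_all
  then have "Im (F1 * F2 * (V (opp G d) - V d)) = - 2 * cos ?t * Re (f F1 * f F2)"
    "Im (F1 * F2 * (U (opp G d) - U d)) = - 2 * sin ?t * Im (f F1 * f F2)"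
    unfolding ff by simp_all
  moreover have "0 < cos ?t" "0 < sin ?t"
    using half_angle_bounds[of d] by (auto intro: cos_gt_zero_pi sin_gt_zero)
  ultimately show "cos (\<theta> d) / cos (half_ang d) * (1/2 * Im (F1 * F2 * (V (opp G d) - V d)))
      = (p1 + p2 - p0 - p3) / 2"
    "sin (\<theta> d) / sin (half_ang d) * (1/2 * Im (F1 * F2 * (U (opp G d) - U d)))
      = (p0 + p1 - p2 - p3) / 2"
    using products by (simp_all del: times_complex.sel)
qed

end

section \<open>The discrete contour integrals\<close>

lemma count_list_concat_pairs:
  "count_list (concat (map (\<lambda>d. [(f d, True), (g d, False)]) ds)) (x, True)
     = count_list (map f ds) x"
  "count_list (concat (map (\<lambda>d. [(f d, True), (g d, False)]) ds)) (x, False)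
     = count_list (map g ds) x"
  by (induction ds) auto

lemma count_list_map_inverse:
  assumes "\<And>d. f d = x \<longleftrightarrow> d = y"
  shows "count_list (map f ds) x = count_list ds y"
  by (induction ds) (auto simp: assms)

lemma sum_list_indicator:
  fixes y :: real
  shows "(\<Sum>d\<leftarrow>ds. if d = c then y else 0) = of_nat (count_list ds c) * y"
  by (induction ds) (auto simp: algebra_simps)

locale isoradial_spinor_pair =
  spinor_pair G \<theta> c D \<Omega> K1 K2 \<iota> X1 X2 + isoradial G pos \<delta>
  for G :: "'d emb_graph" and \<theta> :: "'d \<Rightarrow> real" and c :: 'd and D :: "'d set"
    and \<Omega> :: "'d lam_vertex set"
    and K1 :: "('d, 'l1) dcover" and K2 :: "('d, 'l2) dcover" and \<iota> :: "'l1 \<Rightarrow> 'l2"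
    and X1 :: "'l1 \<Rightarrow> real" and X2 :: "'l2 \<Rightarrow> real"
    and pos :: "'d lam_vertex \<Rightarrow> complex" and \<delta> :: real +
  fixes F1 F2 :: "complex \<Rightarrow> complex"
  assumes s_hol: "massive_s_hol_pair G pos \<delta> \<theta> D c K1 K2 \<iota> X1 X2 F1 F2"
begin

definition black_term :: "'d \<Rightarrow> real" where
  "black_term d = cos (\<theta> d) / cos (half_angle G pos d) *
     (1/2 * Im (F1 (center G pos d) * F2 (center G pos d) * (V (opp G d) - V d)))"

definition white_term :: "'d \<Rightarrow> real" where
  "white_term d = sin (\<theta> d) / sin (half_angle G pos d) *
     (1/2 * Im (F1 (center G pos d) * F2 (center G pos d) * (U (opp G d) - U d)))"

text \<open>
  Each term is the increment of the form along two sides of the rhombus.  If \<open>c\<close> is one of these sides,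
  the lifts do not correspond to each other there, and the increment is taken along the other two
  sides; the defect of the form then appears exactly for \<open>d = c\<close>, where the quad is \<open>z\<^sup>-\<close>.
\<close>

lemma
  assumes d: "d \<in> D"
  shows black_term_eq: "black_term d = corner_prod (nextf G d) - corner_prod d + (if d = c then 2 * corner_prod c else 0)"
    and white_term_eq: "white_term d
      = corner_prod d - corner_prod (nextf G (opp G d)) - (if d = c then 2 * corner_prod c else 0)"
proof -
  obtain l1 l2 \<beta> where l: "proj K1 l1 = d" "proj K2 l2 = d"
    and \<iota>: "\<And>j. j < 4 \<Longrightarrow> proj K1 (quad_lift K1 l1 ! j) \<noteq> c \<Longrightarrow> \<iota> (quad_lift K1 l1 ! j) = quad_lift K2 l2 ! j"
    and \<beta>: "sgn (V d - center G pos d) = cis \<beta>"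
    and F: "s_hol_value G pos \<delta> \<theta> K1 X1 l1 \<beta> (F1 (center G pos d))"
      "s_hol_value G pos \<delta> \<theta> K2 X2 l2 \<beta> (F2 (center G pos d))"
    using s_hol d unfolding massive_s_hol_pair_def by blast
  note pr = proj_lift[OF double_covers(1), of l1, unfolded l]
  define p0 where "p0 = X1 l1 * X2 l2"
  define p1 where "p1 = X1 (lift1 K1 l1) * X2 (lift1 K2 l2)"
  define p2 where "p2 = X1 (lift2 K1 l1) * X2 (lift2 K2 l2)"
  define p3 where "p3 = X1 (lift3 K1 l1) * X2 (lift3 K2 l2)"
  have p0: "corner_prod d = p0" if "d \<noteq> c"
    using \<iota>[of 0] corner_prod_eq[of l1] that l by (simp add: lift_quad_lift p0_def)
  have p1: "corner_prod (nextf G d) = p1" if "nextf G d \<noteq> c"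
    using \<iota>[of 1] corner_prod_eq[of "lift1 K1 l1"] that pr by (simp add: lift_quad_lift p1_def)
  have p2: "corner_prod (opp G d) = p2" if "opp G d \<noteq> c"
    using \<iota>[of 2] corner_prod_eq[of "lift2 K1 l1"] that pr by (simp add: lift_quad_lift p2_def)
  have p3: "corner_prod (nextf G (opp G d)) = p3" if "nextf G (opp G d) \<noteq> c"
    using \<iota>[of 3] corner_prod_eq[of "lift3 K1 l1"] that pr
    by (simp add: lift_quad_lift p3_def numeral_3_eq_3)
  have rel: "p0 + p2 = p1 + p3"
    using quad_products[OF l d] by (simp add: p0_def p1_def p2_def p3_def)
  note integrand = integrand_black_white[OF double_covers l \<beta> F, folded black_term_def white_term_def
      p0_def p1_def p2_def p3_def]
  have black: "black_term d = p1 - p0" "black_term d = p2 - p3"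
    using integrand(1) rel by simp_all
  have white: "white_term d = p0 - p3" "white_term d = p1 - p2"
    using integrand(2) rel by simp_all
  have neq: "nextf G x \<noteq> x" "nextf G x \<noteq> opp G x" for x
    using rot_neq[of x] rot_neq[of "opp G x"] by (metis nextf_eq_iff opp_opp)+
  have neq_opp: "x \<noteq> opp G (nextf G x)" "x \<noteq> opp G (nextf G (opp G x))" for x
    using neq[of x] neq[of "opp G x"] by (metis opp_opp)+
  have neq': "nextf G d \<noteq> nextf G (opp G d)" "nextf G (opp G d) \<noteq> d"
    using neq[of "opp G d"] opp_neq[of d, symmetric] by (auto simp: nextf_eq_iff)
  consider "d = c" | "nextf G d = c" | "opp G d = c" | "nextf G (opp G d) = c"
    | "d \<noteq> c" "nextf G d \<noteq> c" "opp G d \<noteq> c" "nextf G (opp G d) \<noteq> c" by blast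
  then have "black_term d = corner_prod (nextf G d) - corner_prod d + (if d = c then 2 * corner_prod c else 0)
      \<and> white_term d = corner_prod d - corner_prod (nextf G (opp G d)) - (if d = c then 2 * corner_prod c else 0)"
  proof cases
    case 1
    then have "opp G d \<noteq> c" "nextf G d \<noteq> c" "nextf G (opp G d) \<noteq> c"
      using neq neq' by auto
    then show ?thesis using 1 p1 p2 p3 black white corner_prod_quad[OF d] by simp
  next
    case 2
    then have "d \<noteq> c" "d \<noteq> opp G c" "opp G d \<noteq> c" "nextf G (opp G d) \<noteq> c"
      using neq[of d] neq' neq_opp by auto
    then show ?thesis using p0 p2 p3 black white corner_prod_quad[OF d] by simp
  next
    case 3
    then have "d \<noteq> c" "nextf G d \<noteq> c" "nextf G (opp G d) \<noteq> c"
      using neq neq' by auto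
    then show ?thesis using p0 p1 p3 black white by simp
  next
    case 4
    then have "d \<noteq> c" "d \<noteq> opp G c" "opp G d \<noteq> c" "nextf G d \<noteq> c"
      using neq[of d] neq[of "opp G d"] neq' neq_opp by auto
    then show ?thesis using p0 p1 p2 black white corner_prod_quad[OF d] by simp
  next
    case 5
    then show ?thesis using p0 p1 p3 black white by simp
  qed
  then show "black_term d = corner_prod (nextf G d) - corner_prod d + (if d = c then 2 * corner_prod c else 0)"
    "white_term d = corner_prod d - corner_prod (nextf G (opp G d)) - (if d = c then 2 * corner_prod c else 0)" by auto
qed

text \<open>
  Each diagonal is replaced by the two sides on its left, through the white vertex \<open>wv d\<close>.  The walk has
  the winding number \<open>turns\<close>, computed on the left of the diagonal, minus the number of passages over the
  triangle between diagonal and sides.  At \<open>c\<close> this is \<open>1\<close> minus the number \<open>n\<close> of steps given by \<open>c\<close>, and the \<open>n\<close>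
  terms \<open>2 corner_prod c\<close> restore the missing part.
\<close>

lemma discrete_integral_black_eq:
  assumes C: "contour_around G pos D c (bv G) ds"
  shows "discrete_integral_black G pos \<theta> F1 F2 ds = 2 * corner_prod c"
proof -
  define \<gamma> where "\<gamma> = concat (map (\<lambda>d. [(nextf G d, True), (d, False)]) ds)"
  define w where "w = (\<lambda>d. turns (bv G) ds d - int (count_list ds d))"
  have dsD: "set ds \<subseteq> D" using C by (simp add: contour_around_def)
  have zero: "turns (bv G) ds d = 0" if "d \<notin> D" for d
    by (rule turns_zero_outside[OF _ C _ mid_segment_off_own_diagonal(1)]) (use opp_in_D that in auto)
  have same: "turns (bv G) ds (nextf G (opp G d)) = turns (bv G) ds (opp G d)" for d
    by (rule turns_black_same_side[OF C])
  have "winding_in G D \<gamma> w"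
    unfolding winding_in_def
  proof (intro conjI allI)
    have "{d. w d \<noteq> 0} \<subseteq> {d. turns (bv G) ds d \<noteq> 0} \<union> set ds"
      by (auto simp: w_def count_list_0_iff)
    then show "finite {d. w d \<noteq> 0}"
      using finite_turns[OF _ C] by (meson finite_UnI finite_set finite_subset)
    show "{d. w d \<noteq> 0} \<subseteq> D" using zero dsD by (force simp: w_def count_list_0_iff)
    show "w (opp G d) = w d" for d using turns_black_jump[OF C, of d] same[of d] by (simp add: w_def)
    fix d
    have "count_list \<gamma> (d, True) = count_list ds (opp G (rot G d))"
      "count_list \<gamma> (d, False) = count_list ds d"
      unfolding \<gamma>_def count_list_concat_pairs
      by (auto intro!: count_list_map_inverse simp: nextf_eq_iff)
    then show "int (count_list \<gamma> (d, True)) - int (count_list \<gamma> (d, False)) = w d - w (rot G d)"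
      using turns_black_jump[OF C, of "rot G d"] by (simp add: w_def)
  qed
  then have "(\<Sum>s\<leftarrow>\<gamma>. signed_prod s) = of_int (w c) * (2 * corner_prod c)" by (rule sum_signed_prod)
  moreover have "(\<Sum>s\<leftarrow>\<gamma>. signed_prod s) = (\<Sum>d\<leftarrow>ds. corner_prod (nextf G d) - corner_prod d)"
    unfolding \<gamma>_def by (induction ds) (auto simp: signed_prod_def)
  moreover have "w c = 1 - int (count_list ds c)"
    using turns_at_corner[OF C] by (simp add: w_def)
  ultimately have boundary: "(\<Sum>d\<leftarrow>ds. corner_prod (nextf G d) - corner_prod d)
      = (1 - real (count_list ds c)) * (2 * corner_prod c)" by simp
  have "discrete_integral_black G pos \<theta> F1 F2 ds
      = (\<Sum>d\<leftarrow>ds. (corner_prod (nextf G d) - corner_prod d) + (if d = c then 2 * corner_prod c else 0))"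
    unfolding discrete_integral_black_def black_term_def[symmetric]
    using dsD black_term_eq by (intro arg_cong[where f = sum_list] map_cong) auto
  also have "\<dots> = (1 - real (count_list ds c)) * (2 * corner_prod c) + real (count_list ds c) * (2 * corner_prod c)"
    unfolding sum_list_addf boundary sum_list_indicator ..
  finally show ?thesis by (simp add: algebra_simps)
qed

text \<open>
  As in the black case, but now the sides through \<open>bv d\<close> are on the right of the diagonal, whence the
  opposite signs of both corrections.
\<close>

lemma discrete_integral_white_eq:
  assumes C: "contour_around G pos D c (wv G) ds"
  shows "discrete_integral_white G pos \<theta> F1 F2 ds = 2 * corner_prod c"
proof -
  define \<gamma> where "\<gamma> = concat (map (\<lambda>d. [(d, True), (nextf G (opp G d), False)]) ds)"
  define w where "w = (\<lambda>d. turns (wv G) ds d + int (count_list ds d))"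
  have dsD: "set ds \<subseteq> D" using C by (simp add: contour_around_def)
  have zero: "turns (wv G) ds d = 0" if "d \<notin> D" for d
    by (rule turns_zero_outside[OF _ C _ mid_segment_off_own_diagonal(2)]) (use opp_in_D that in auto)
  have "winding_in G D \<gamma> w"
    unfolding winding_in_def
  proof (intro conjI allI)
    have "{d. w d \<noteq> 0} \<subseteq> {d. turns (wv G) ds d \<noteq> 0} \<union> set ds"
      by (auto simp: w_def count_list_0_iff)
    then show "finite {d. w d \<noteq> 0}"
      using finite_turns[OF _ C] by (meson finite_UnI finite_set finite_subset)
    show "{d. w d \<noteq> 0} \<subseteq> D" using zero dsD by (force simp: w_def count_list_0_iff)
    show "w (opp G d) = w d" for d
      using turns_white_jump[OF C, of d] turns_white_same_side[OF C, of "opp G d"] by (simp add: w_def)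
    fix d
    have "count_list \<gamma> (d, True) = count_list ds d"
      "count_list \<gamma> (d, False) = count_list ds (rot G d)"
      unfolding \<gamma>_def count_list_concat_pairs
      by (auto intro!: count_list_map_inverse simp: nextf_eq_iff)
    then show "int (count_list \<gamma> (d, True)) - int (count_list \<gamma> (d, False)) = w d - w (rot G d)"
      using turns_white_same_side[OF C, of "rot G d"] by (simp add: w_def)
  qed
  then have "(\<Sum>s\<leftarrow>\<gamma>. signed_prod s) = of_int (w c) * (2 * corner_prod c)" by (rule sum_signed_prod)
  moreover have "(\<Sum>s\<leftarrow>\<gamma>. signed_prod s) = (\<Sum>d\<leftarrow>ds. corner_prod d - corner_prod (nextf G (opp G d)))"
    unfolding \<gamma>_def by (induction ds) (auto simp: signed_prod_def)
  moreover have "w c = 1 + int (count_list ds c)"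
    using turns_at_corner[OF C] by (simp add: w_def)
  ultimately have boundary: "(\<Sum>d\<leftarrow>ds. corner_prod d - corner_prod (nextf G (opp G d)))
      = (1 + real (count_list ds c)) * (2 * corner_prod c)" by simp
  have "discrete_integral_white G pos \<theta> F1 F2 ds
      = (\<Sum>d\<leftarrow>ds. (corner_prod d - corner_prod (nextf G (opp G d))) - (if d = c then 2 * corner_prod c else 0))"
    unfolding discrete_integral_white_def white_term_def[symmetric]
    using dsD white_term_eq by (intro arg_cong[where f = sum_list] map_cong) auto
  also have "\<dots> = (1 + real (count_list ds c)) * (2 * corner_prod c) - real (count_list ds c) * (2 * corner_prod c)"
    by (subst sum_list_subtractf) (simp only: boundary sum_list_indicator)
  finally show ?thesis by (simp add: algebra_simps)
qed

end

theorem lemma3p14: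
  fixes G :: "'d emb_graph" and \<theta> :: "'d \<Rightarrow> real" and c :: 'd and D :: "'d set"
    and \<Omega> :: "'d lam_vertex set"
    and K1 :: "('d, 'l1) dcover" and K2 :: "('d, 'l2) dcover" and \<iota> :: "'l1 \<Rightarrow> 'l2"
    and X1 :: "'l1 \<Rightarrow> real" and X2 :: "'l2 \<Rightarrow> real" and lc :: 'l1
  assumes "planar_graph G" and "quad_angles G \<theta>"
    and "\<forall>d. opp G d \<in> D \<longleftrightarrow> d \<in> D" and "c \<in> D" and "rot G c \<in> D"
    and "bv G c \<notin> \<Omega>" and "wv G c \<notin> \<Omega>"
    and "upsilon_cover G (insert (bv G c) \<Omega>) K1" and "upsilon_cover G (insert (wv G c) \<Omega>) K2"
    and "spinor K1 X1" and "propagation G \<theta> D K1 X1"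
    and "spinor K2 X2" and "propagation G \<theta> D K2 X2"
    and "cover_identification G c K1 K2 \<iota>"
    and "proj K1 lc = c"
  shows "(\<forall>\<gamma> w h. closed_walk G \<gamma> \<and> (\<forall>s \<in> set \<gamma>. fst s \<noteq> c \<and> (fst s \<in> D \<or> rot G (fst s) \<in> D)) \<and>
            winding_in G D \<gamma> w \<and> H_along K1 \<iota> X1 X2 \<gamma> h \<longrightarrow>
            h (length \<gamma>) - h 0 = of_int (w c) * (2 * X1 lc * X2 (\<iota> lc))) \<and>
         (\<forall>pos \<delta> m F1 F2. isoradial_grid G pos \<delta> \<and> \<bar>m * \<delta> / 2\<bar> < 1 \<and>
            Z_invariant G pos (m * \<delta> / 2) \<theta> \<and>
            massive_s_hol_pair G pos \<delta> \<theta> D c K1 K2 \<iota> X1 X2 F1 F2 \<longrightarrow>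
            (\<forall>ds. contour_around G pos D c (bv G) ds \<longrightarrow>
               2 * X1 lc * X2 (\<iota> lc) = discrete_integral_black G pos \<theta> F1 F2 ds) \<and>
            (\<forall>ds. contour_around G pos D c (wv G) ds \<longrightarrow>
               2 * X1 lc * X2 (\<iota> lc) = discrete_integral_white G pos \<theta> F1 F2 ds))"
proof -
  interpret dart_graph G using assms(1) by (rule planar_graph_imp_dart_graph)
  interpret spinor_pair G \<theta> c D \<Omega> K1 K2 \<iota> X1 X2
    by unfold_locales (use assms in \<open>auto simp: planar_graph_def quad_angles_def\<close>)
  have prod_c: "2 * X1 lc * X2 (\<iota> lc) = 2 * corner_prod c" using corner_prod_eq[of lc] assms(15) by simp
  show ?thesis
    unfolding prod_c
  proof (intro conjI allI impI; elim conjE)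
    fix \<gamma> w h
    assume "winding_in G D \<gamma> w" "H_along K1 \<iota> X1 X2 \<gamma> h"
    then show "h (length \<gamma>) - h 0 = of_int (w c) * (2 * corner_prod c)"
      using H_increment sum_signed_prod by metis
  next
    fix pos \<delta> m F1 F2 ds
    assume "isoradial_grid G pos \<delta>" "massive_s_hol_pair G pos \<delta> \<theta> D c K1 K2 \<iota> X1 X2 F1 F2"
      and C: "contour_around G pos D c (bv G) ds"
    then interpret isoradial_spinor_pair G \<theta> c D \<Omega> K1 K2 \<iota> X1 X2 pos \<delta> F1 F2
      by unfold_locales
    show "2 * corner_prod c = discrete_integral_black G pos \<theta> F1 F2 ds"
      using discrete_integral_black_eq[OF C] by simp
  next
    fix pos \<delta> m F1 F2 ds
    assume "isoradial_grid G pos \<delta>" "massive_s_hol_pair G pos \<delta> \<theta> D c K1 K2 \<iota> X1 X2 F1 F2"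
      and C: "contour_around G pos D c (wv G) ds"
    then interpret isoradial_spinor_pair G \<theta> c D \<Omega> K1 K2 \<iota> X1 X2 pos \<delta> F1 F2
      by unfold_locales
    show "2 * corner_prod c = discrete_integral_white G pos \<theta> F1 F2 ds"
      using discrete_integral_white_eq[OF C] by simp
  qed
qed

end
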